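(* Let $\boldsymbol{g}:\Theta\subseteq\mathbb{R}^p\to\mathbb{R}^r$, $r<p$, be such that the $p\times r$ matrix $\boldsymbol{G}(\boldsymbol{\theta})=\partial\boldsymbol{g}^T(\boldsymbol{\theta})/\partial\boldsymbol{\theta}$ exists, is continuous in $\boldsymbol{\theta}$ and has rank $r$. Let $\boldsymbol{y}_1,\dots,\boldsymbol{y}_n$ be i.i.d. observations from $f(\cdot;\boldsymbol{\theta})$, where the true parameter $\boldsymbol{\theta}$ satisfies $\boldsymbol{g}(\boldsymbol{\theta})=\boldsymbol{0}_r$, and let $\widehat{\boldsymbol{\theta}}_c$ and $\widetilde{\boldsymbol{\theta}}_{rc}$ be the unrestricted and the restricted maximum composite likelihood estimators of $\boldsymbol{\theta}$. Assume the regularity assumptions of the context. Then $$\sqrt{n}(\widetilde{\boldsymbol{\theta}}_{rc}-\boldsymbol{\theta})=\left(\boldsymbol{I}_p+\boldsymbol{Q}(\boldsymbol{\theta})\boldsymbol{G}^T(\boldsymbol{\theta})\right)\sqrt{n}(\widehat{\boldsymbol{\theta}}_c-\boldsymbol{\theta})+o_P(1),$$ where $\boldsymbol{Q}(\boldsymbol{\theta})=-\boldsymbol{H}^{-1}(\boldsymbol{\theta})\boldsymbol{G}(\boldsymbol{\theta})\left[\boldsymbol{G}^T(\boldsymbol{\theta})\boldsymbol{H}^{-1}(\boldsymbol{\theta})\boldsymbol{G}(\boldsymbol{\theta})\right]^{-1}$ and $\boldsymbol{I}_p$ is the $p\times p$ identity matrix.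
   Context: Model and composite likelihood. $\{f(\cdot;\boldsymbol{\theta}):\boldsymbol{\theta}\in\Theta\subseteq\mathbb{R}^p\}$, $p\ge1$, is an identifiable parametric family of densities of a random vector $\boldsymbol{Y}$ in $\mathbb{R}^m$; $E_{\boldsymbol{\theta}}$, $Var_{\boldsymbol{\theta}}$ refer to $\boldsymbol{Y}\sim f(\cdot;\boldsymbol{\theta})$. Given $K$ marginal or conditional densities $f_{A_k}(y_j,j\in A_k;\boldsymbol{\theta})$ derived from $f(\cdot;\boldsymbol{\theta})$ and known weights $w_k\ge0$, the composite density is $\mathcal{CL}(\boldsymbol{\theta},\boldsymbol{y})=\prod_{k=1}^K f_{A_k}^{w_k}(y_j,j\in A_k;\boldsymbol{\theta})$ and the composite log-density is $c\ell(\boldsymbol{\theta},\boldsymbol{y})=\log\mathcal{CL}(\boldsymbol{\theta},\boldsymbol{y})$. The score is $\boldsymbol{u}(\boldsymbol{\theta},\boldsymbol{y})=\partial c\ell(\boldsymbol{\theta},\boldsymbol{y})/\partial\boldsymbol{\theta}$. Estimators. $\widehat{\boldsymbol{\theta}}_c$ maximizes $\sum_{i=1}^n c\ell(\boldsymbol{\theta},\boldsymbol{y}_i)$ over $\Theta$ and solves $\sum_{i=1}^n\boldsymbol{u}(\boldsymbol{\theta},\boldsymbol{y}_i)=\boldsymbol{0}_p$. The restricted estimator $\widetilde{\boldsymbol{\theta}}_{rc}$ maximizes the same function over $\{\boldsymbol{\theta}\in\Theta:\boldsymbol{g}(\boldsymbol{\theta})=\boldsymbol{0}_r\}$ and is obtained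 as a solution of $\sum_{i=1}^n\boldsymbol{u}(\boldsymbol{\theta},\boldsymbol{y}_i)+\boldsymbol{G}(\boldsymbol{\theta})\boldsymbol{\lambda}=\boldsymbol{0}_p$, $\boldsymbol{g}(\boldsymbol{\theta})=\boldsymbol{0}_r$, with $\boldsymbol{\lambda}\in\mathbb{R}^r$ a vector of Lagrange multipliers. Matrices. $\boldsymbol{H}(\boldsymbol{\theta})=E_{\boldsymbol{\theta}}[-\frac{\partial}{\partial\boldsymbol{\theta}}\boldsymbol{u}^T(\boldsymbol{\theta},\boldsymbol{Y})]$ and $\boldsymbol{J}(\boldsymbol{\theta})=Var_{\boldsymbol{\theta}}[\boldsymbol{u}(\boldsymbol{\theta},\boldsymbol{Y})]$, both assumed positive definite. Regularity assumptions (the standard ones of asymptotic statistics). The true parameter is interior to $\Theta$; the set $\{\boldsymbol{y}:\mathcal{CL}(\boldsymbol{\theta},\boldsymbol{y})>0\}$ does not depend on $\boldsymbol{\theta}$; for almost every $\boldsymbol{y}$, $c\ell(\cdot,\boldsymbol{y})$ is three times continuously differentiable near the true parameter, with third derivatives dominated by a function of $\boldsymbol{y}$ with finite expectation; $E_{\boldsymbol{\theta}}[\boldsymbol{u}(\boldsymbol{\theta},\boldsymbol{Y})]=\boldsymbol{0}_p$ and $\boldsymbol{H},\boldsymbol{J}$ are finite; $\widehat{\boldsymbol{\theta}}_c$ and $\widetilde{\boldsymbol{\theta}}_{rc}$ are consistent sequences of estimators solving the respective likelihood equations. *)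

theory Defs
  imports "HOL-Probability.Probability"
begin

text \<open>
  Densities on \<open>\<real>\<^sup>m\<close> are taken with respect to a product of sigma-finite Borel measures
  \<open>\<nu> j\<close> on the line, one per coordinate, so that discrete and continuous coordinates are both
  covered; \<open>\<nu> = (\<lambda>_. lborel)\<close> gives Lebesgue densities.
\<close>

definition dominating :: "('m::finite \<Rightarrow> real measure) \<Rightarrow> (real ^ 'm) measure" where
  "dominating \<nu> = distr (PiM UNIV \<nu>) borel (\<lambda>x. \<chi> j. x j)"

definition law ::
    "('m::finite \<Rightarrow> real measure) \<Rightarrow> (real ^ 'p \<Rightarrow> real ^ 'm \<Rightarrow> real) \<Rightarrow> real ^ 'p \<Rightarrow> (real ^ 'm) measure" where
  "law \<nu> f \<theta> = density (dominating \<nu>) (\<lambda>y. ennreal (f \<theta> y))"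

text \<open>
  The Bochner integral is 0 where the marginal integral diverges, which for a probability
  density \<open>h\<close> happens only on a null set.
\<close>

definition marginal_density ::
    "('m::finite \<Rightarrow> real measure) \<Rightarrow> 'm set \<Rightarrow> (real ^ 'm \<Rightarrow> real) \<Rightarrow> real ^ 'm \<Rightarrow> real" where
  "marginal_density \<nu> A h y = (LINT z|PiM (- A) \<nu>. h (\<chi> j. if j \<in> A then y $ j else z j))"

text \<open>
  For \<open>B \<subset> A\<close> this is the conditional density of \<open>(y\<^sub>j, j \<in> A - B)\<close> given \<open>(y\<^sub>j, j \<in> B)\<close>.
  If \<open>B\<close> is empty, the denominator is the total mass 1 of the density and one obtains
  the marginal density of \<open>(y\<^sub>j, j \<in> A)\<close>.
\<close>

definition component_density ::
    "('m::finite \<Rightarrow> real measure) \<Rightarrow> 'm set \<Rightarrow> 'm set \<Rightarrow> (real ^ 'm \<Rightarrow> real) \<Rightarrow> real ^ 'm \<Rightarrow> real" where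
  "component_density \<nu> A B h y = marginal_density \<nu> A h y / marginal_density \<nu> B h y"

text \<open>The case distinction is needed because \<open>0 powr 0 = 0\<close>: a factor of weight 0 must be 1.\<close>

definition composite_density ::
    "('m::finite \<Rightarrow> real measure) \<Rightarrow> nat \<Rightarrow> (nat \<Rightarrow> 'm set) \<Rightarrow> (nat \<Rightarrow> 'm set) \<Rightarrow> (nat \<Rightarrow> real) \<Rightarrow>
     (real ^ 'p \<Rightarrow> real ^ 'm \<Rightarrow> real) \<Rightarrow> real ^ 'p \<Rightarrow> real ^ 'm \<Rightarrow> real" where
  "composite_density \<nu> K A B w f \<theta> y =
     (\<Prod>k<K. if w k = 0 then 1 else component_density \<nu> (A k) (B k) (f \<theta>) y powr w k)"

text \<open>
  Where the composite density vanishes, its logarithm has the library's conventional value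
  \<open>ln 0 = 0\<close> instead of \<open>-\<infinity>\<close>. If the set where the composite density is positive does not
  depend on the parameter, then observations lie in that set almost surely.
\<close>

definition composite_log_density ::
    "('m::finite \<Rightarrow> real measure) \<Rightarrow> nat \<Rightarrow> (nat \<Rightarrow> 'm set) \<Rightarrow> (nat \<Rightarrow> 'm set) \<Rightarrow> (nat \<Rightarrow> real) \<Rightarrow>
     (real ^ 'p \<Rightarrow> real ^ 'm \<Rightarrow> real) \<Rightarrow> real ^ 'p \<Rightarrow> real ^ 'm \<Rightarrow> real" where
  "composite_log_density \<nu> K A B w f \<theta> y = ln (composite_density \<nu> K A B w f \<theta> y)"

definition partial_deriv :: "'p::finite \<Rightarrow> (real ^ 'p \<Rightarrow> real) \<Rightarrow> real ^ 'p \<Rightarrow> real" where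
  "partial_deriv i h x = deriv (\<lambda>t. h (x + t *\<^sub>R axis i 1)) 0"

text \<open>\<open>k\<close> times continuously differentiable on \<open>S\<close>, intended for open \<open>S\<close>.\<close>

primrec Ck_on :: "nat \<Rightarrow> (real ^ 'p::finite \<Rightarrow> real) \<Rightarrow> (real ^ 'p) set \<Rightarrow> bool" where
  "Ck_on 0 h S \<longleftrightarrow> continuous_on S h"
| "Ck_on (Suc k) h S \<longleftrightarrow>
     (\<forall>x\<in>S. h differentiable (at x)) \<and> (\<forall>i. Ck_on k (partial_deriv i h) S)"

definition score ::
    "(real ^ 'p::finite \<Rightarrow> real ^ 'm \<Rightarrow> real) \<Rightarrow> real ^ 'p \<Rightarrow> real ^ 'm \<Rightarrow> real ^ 'p" where
  "score cl \<theta> y = (\<chi> i. partial_deriv i (\<lambda>t. cl t y) \<theta>)"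

definition score_deriv ::
    "(real ^ 'p::finite \<Rightarrow> real ^ 'm \<Rightarrow> real) \<Rightarrow> real ^ 'p \<Rightarrow> real ^ 'm \<Rightarrow> real ^ 'p ^ 'p" where
  "score_deriv cl \<theta> y = (\<chi> i j. partial_deriv i (\<lambda>t. score cl t y $ j) \<theta>)"

definition H_matrix ::
    "(real ^ 'm) measure \<Rightarrow> (real ^ 'p::finite \<Rightarrow> real ^ 'm \<Rightarrow> real) \<Rightarrow> real ^ 'p \<Rightarrow> real ^ 'p ^ 'p" where
  "H_matrix P cl \<theta> = (\<chi> i j. LINT y|P. - score_deriv cl \<theta> y $ i $ j)"

definition J_matrix ::
    "(real ^ 'm) measure \<Rightarrow> (real ^ 'p::finite \<Rightarrow> real ^ 'm \<Rightarrow> real) \<Rightarrow> real ^ 'p \<Rightarrow> real ^ 'p ^ 'p" where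
  "J_matrix P cl \<theta> =
     (\<chi> i j. LINT y|P. (score cl \<theta> y $ i - (LINT x|P. score cl \<theta> x $ i))
                      * (score cl \<theta> y $ j - (LINT x|P. score cl \<theta> x $ j)))"

definition positive_definite :: "real ^ 'n ^ 'n \<Rightarrow> bool" where
  "positive_definite A \<longleftrightarrow> transpose A = A \<and> (\<forall>x. x \<noteq> 0 \<longrightarrow> x \<bullet> (A *v x) > 0)"

text \<open>The \<open>p \<times> r\<close> matrix with entries \<open>\<partial>g\<^sub>j / \<partial>\<theta>\<^sub>i\<close>, i.e. the transposed Jacobian.\<close>

definition G_matrix :: "(real ^ 'p::finite \<Rightarrow> real ^ 'r::finite) \<Rightarrow> real ^ 'p \<Rightarrow> real ^ 'r ^ 'p" where
  "G_matrix g \<theta> = transpose (jacobian g (at \<theta>))"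

definition Q_matrix :: "real ^ 'p ^ 'p::finite \<Rightarrow> real ^ 'r ^ 'p \<Rightarrow> real ^ 'r::finite ^ 'p" where
  "Q_matrix H G = - (matrix_inv H ** G ** matrix_inv (transpose G ** matrix_inv H ** G))"

definition unrestricted_mcle ::
    "(real ^ 'p::finite) set \<Rightarrow> (real ^ 'p \<Rightarrow> real ^ 'm \<Rightarrow> real) \<Rightarrow> nat \<Rightarrow> (nat \<Rightarrow> real ^ 'm) \<Rightarrow>
     real ^ 'p \<Rightarrow> bool" where
  "unrestricted_mcle \<Theta> cl n y t \<longleftrightarrow>
     t \<in> \<Theta> \<and> (\<forall>s\<in>\<Theta>. (\<Sum>i<n. cl s (y i)) \<le> (\<Sum>i<n. cl t (y i))) \<and>
     (\<Sum>i<n. score cl t (y i)) = 0"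

definition restricted_mcle ::
    "(real ^ 'p::finite) set \<Rightarrow> (real ^ 'p \<Rightarrow> real ^ 'r::finite) \<Rightarrow> (real ^ 'p \<Rightarrow> real ^ 'm \<Rightarrow> real) \<Rightarrow>
     nat \<Rightarrow> (nat \<Rightarrow> real ^ 'm) \<Rightarrow> real ^ 'p \<Rightarrow> bool" where
  "restricted_mcle \<Theta> g cl n y t \<longleftrightarrow>
     t \<in> \<Theta> \<and> g t = 0 \<and>
     (\<forall>s\<in>\<Theta>. g s = 0 \<longrightarrow> (\<Sum>i<n. cl s (y i)) \<le> (\<Sum>i<n. cl t (y i))) \<and>
     (\<exists>l. (\<Sum>i<n. score cl t (y i)) + G_matrix g t *v l = 0)"

definition tendsto_in_prob ::
    "'w measure \<Rightarrow> (nat \<Rightarrow> 'w \<Rightarrow> 'a::metric_space) \<Rightarrow> 'a \<Rightarrow> bool" where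
  "tendsto_in_prob M X c \<longleftrightarrow>
     (\<forall>e>0. (\<lambda>n. measure M {\<omega> \<in> space M. dist (X n \<omega>) c > e}) \<longlonglongrightarrow> 0)"

definition o_P_1 :: "'w measure \<Rightarrow> (nat \<Rightarrow> 'w \<Rightarrow> 'a::real_normed_vector) \<Rightarrow> bool" where
  "o_P_1 M X \<longleftrightarrow> tendsto_in_prob M X 0"

text \<open>
  An estimator need not exist for every sample (for small \<open>n\<close> the maximum is often not attained
  at all), so its defining properties are required on events whose probability tends to 1. The
  events \<open>E n\<close> avoid assuming that the set of all \<open>\<omega>\<close> with \<open>Q n \<omega>\<close> is measurable.
\<close>

definition with_prob_tending_to_1 :: "'w measure \<Rightarrow> (nat \<Rightarrow> 'w \<Rightarrow> bool) \<Rightarrow> bool" where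
  "with_prob_tending_to_1 M Q \<longleftrightarrow>
     (\<exists>E. (\<forall>n. E n \<in> sets M \<and> (\<forall>\<omega>\<in>E n. Q n \<omega>)) \<and> (\<lambda>n. measure M (E n)) \<longlonglongrightarrow> 1)"

end

theory Submission
  imports Defs
begin

text \<open>
  Let \<open>s\<close> be the normalised score \<open>n\<^bsup>-1/2\<^esup> \<Sum>u(\<theta>, y\<^sub>i)\<close>, and let \<open>a\<close>, \<open>b\<close> be
  \<open>n\<^bsup>1/2\<^esup>(t - \<theta>)\<close> with \<open>t\<close> the unrestricted and the restricted estimator. Expanding the score
  and the constraint at \<open>\<theta>\<close> turns the likelihood equations into \<open>H a = s + e\<^sub>1\<close>,
  \<open>H b = s + G l + e\<^sub>2\<close> and \<open>G\<^sup>T b = e\<^sub>3\<close>. By the weak law of large numbers and consistency, for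
  every \<open>\<delta> > 0\<close> the errors are, with probability tending to 1, at most \<open>\<delta>\<close> times the norms of
  \<open>a\<close>, \<open>b\<close> and \<open>l\<close>. Linear algebra then bounds \<open>b - (I + Q G\<^sup>T) a\<close> by a multiple of \<open>\<delta> \<parallel>s\<parallel>\<close>.
  Only tightness of \<open>s\<close> is needed to conclude, and this follows from its second moment; no central
  limit theorem enters.
\<close>

subsection \<open>Second-order Taylor remainder\<close>

text \<open>\<open>partial_deriv\<close> is a value chosen by \<open>deriv\<close> and carries no
  information by itself. Restricting the total derivative \<open>L\<close> to the line through
  \<open>x\<close> along \<open>axis i 1\<close> identifies it as \<open>L (axis i 1)\<close>, and
  linearity recovers \<open>L\<close> from these values.\<close>

lemma differentiable_has_derivative_partial_deriv:
  fixes h :: "real ^ 'p::finite \<Rightarrow> real"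
  assumes "h differentiable (at x)"
  shows "(h has_derivative (\<lambda>v. \<Sum>i\<in>UNIV. v $ i * partial_deriv i h x)) (at x)"
proof -
  obtain L where L: "(h has_derivative L) (at x)"
    using assms by (auto simp: differentiable_def)
  then interpret L: bounded_linear L
    by (rule has_derivative_bounded_linear)
  have part: "partial_deriv i h x = L (axis i 1)" for i
  proof -
    have "((\<lambda>t::real. h (x + t *\<^sub>R axis i 1)) has_derivative (\<lambda>t. L (t *\<^sub>R axis i 1))) (at 0)"
      by (rule has_derivative_compose[of _ _ _ _ h L]) (auto intro!: derivative_eq_intros simp: L)
    then have "((\<lambda>t::real. h (x + t *\<^sub>R axis i 1)) has_real_derivative L (axis i 1)) (at 0)"
      unfolding has_field_derivative_def
      by (rule has_derivative_eq_rhs) (simp add: fun_eq_iff L.scaleR)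
    then show ?thesis
      unfolding partial_deriv_def by (rule DERIV_imp_deriv)
  qed
  have expand: "L v = (\<Sum>i\<in>UNIV. v $ i * L (axis i 1))" for v
  proof -
    have "L v = L (\<Sum>i\<in>UNIV. v $ i *\<^sub>R axis i 1)"
      using basis_expansion[of v] by (simp add: scalar_mult_eq_scaleR)
    then show ?thesis
      by (simp add: L.sum L.scaleR)
  qed
  have "L = (\<lambda>v. \<Sum>i\<in>UNIV. v $ i * partial_deriv i h x)"
    unfolding part by (rule ext) (rule expand)
  then show ?thesis
    using L by simp
qed

text \<open>Chain rule in a shape that can be used twice: for \<open>h\<close>, and again for every
  \<open>partial_deriv i h\<close>.\<close>

lemma has_real_derivative_along_segment:
  fixes h :: "real ^ 'p::finite \<Rightarrow> real"
  assumes "h differentiable (at (x + s *\<^sub>R v))"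
  shows "((\<lambda>s. h (x + s *\<^sub>R v)) has_real_derivative
    (\<Sum>i\<in>UNIV. v $ i * partial_deriv i h (x + s *\<^sub>R v))) (at s)"
proof -
  have "((\<lambda>s. h (x + s *\<^sub>R v)) has_derivative
    (\<lambda>c. \<Sum>i\<in>UNIV. (c *\<^sub>R v) $ i * partial_deriv i h (x + s *\<^sub>R v))) (at s)"
    by (rule has_derivative_compose[where f = "\<lambda>s. x + s *\<^sub>R v" and g = h,
        OF _ differentiable_has_derivative_partial_deriv[OF assms]])
      (auto intro!: derivative_eq_intros)
  then show ?thesis
    unfolding has_field_derivative_def
    by (rule has_derivative_eq_rhs) (simp add: fun_eq_iff sum_distrib_left mult_ac)
qed

text \<open>Two uses of the mean value theorem along the segment from \<open>x\<close> to
  \<open>t\<close>. It will be applied to a component of the score, so that \<open>D\<close> bounds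
  third derivatives of the composite log-density.\<close>

lemma second_order_remainder_bound:
  fixes h :: "real ^ 'p::finite \<Rightarrow> real"
  assumes C2: "Ck_on 2 h S" and S: "ball x \<rho> \<subseteq> S" "t \<in> ball x \<rho>"
    and bound: "\<And>z i k. z \<in> S \<Longrightarrow> \<bar>partial_deriv k (partial_deriv i h) z\<bar> \<le> D"
  shows "\<bar>h t - h x - (\<Sum>i\<in>UNIV. (t - x) $ i * partial_deriv i h x)\<bar>
    \<le> (real CARD('p))\<^sup>2 * D * (norm (t - x))\<^sup>2"
proof -
  define v where "v = t - x"
  have seg: "x + s *\<^sub>R v \<in> S" if "0 \<le> s" "s \<le> 1" for s
  proof -
    have "s * norm v \<le> 1 * norm v"
      using that by (intro mult_right_mono) auto
    then have "x + s *\<^sub>R v \<in> ball x \<rho>"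
      using S(2) that by (simp add: dist_norm v_def norm_minus_commute)
    then show ?thesis using S(1) by auto
  qed
  have d1: "h differentiable (at z)" and d2: "partial_deriv i h differentiable (at z)"
    if "z \<in> S" for z i
    using C2 that by (auto simp: numeral_2_eq_2)
  define \<phi>' where "\<phi>' s = (\<Sum>i\<in>UNIV. v $ i * partial_deriv i h (x + s *\<^sub>R v))" for s
  define \<phi>'' where "\<phi>'' s = (\<Sum>i\<in>UNIV. v $ i *
      (\<Sum>k\<in>UNIV. v $ k * partial_deriv k (partial_deriv i h) (x + s *\<^sub>R v)))" for s
  have D1: "((\<lambda>s. h (x + s *\<^sub>R v)) has_real_derivative \<phi>' s) (at s)" if "0 \<le> s" "s \<le> 1" for s
    unfolding \<phi>'_def by (rule has_real_derivative_along_segment[OF d1[OF seg[OF that]]])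
  have D2: "(\<phi>' has_real_derivative \<phi>'' s) (at s)" if "0 \<le> s" "s \<le> 1" for s
    unfolding \<phi>'_def[abs_def] \<phi>''_def
    by (intro DERIV_sum DERIV_cmult has_real_derivative_along_segment d2 seg that)
  have B: "\<bar>\<phi>'' s\<bar> \<le> (real CARD('p))\<^sup>2 * D * (norm v)\<^sup>2" if "0 \<le> s" "s \<le> 1" for s
  proof -
    have term_le: "\<bar>v $ k * partial_deriv k (partial_deriv i h) (x + s *\<^sub>R v)\<bar> \<le> norm v * D" for i k
      unfolding abs_mult by (rule mult_mono[OF component_le_norm_cart bound[OF seg[OF that]]]) auto
    have "\<bar>\<Sum>k\<in>UNIV. v $ k * partial_deriv k (partial_deriv i h) (x + s *\<^sub>R v)\<bar>
        \<le> (\<Sum>k\<in>(UNIV::'p set). norm v * D)" for i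
      by (rule order_trans[OF sum_abs sum_mono]) (rule term_le)
    then have "\<bar>v $ i * (\<Sum>k\<in>UNIV. v $ k * partial_deriv k (partial_deriv i h) (x + s *\<^sub>R v))\<bar>
        \<le> norm v * (\<Sum>k\<in>(UNIV::'p set). norm v * D)" for i
      unfolding abs_mult by (rule mult_mono[OF component_le_norm_cart]) auto
    then have "\<bar>\<phi>'' s\<bar> \<le> (\<Sum>i\<in>(UNIV::'p set). norm v * (\<Sum>k\<in>(UNIV::'p set). norm v * D))"
      unfolding \<phi>''_def by (rule order_trans[OF sum_abs sum_mono])
    then show ?thesis
      by (simp add: power2_eq_square mult_ac)
  qed
  obtain \<xi> where \<xi>: "0 < \<xi>" "\<xi> < 1" "h (x + 1 *\<^sub>R v) - h (x + 0 *\<^sub>R v) = (1 - 0) * \<phi>' \<xi>"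
    using MVT2[of 0 1 "\<lambda>s. h (x + s *\<^sub>R v)" \<phi>'] D1 by auto
  \<comment> \<open>The iterated mean value theorem leaves a factor \<open>\<xi> < 1\<close> where
    the Lagrange remainder has 1/2; this costs only a constant.\<close>
  obtain \<eta> where \<eta>: "0 < \<eta>" "\<eta> < \<xi>" "\<phi>' \<xi> - \<phi>' 0 = (\<xi> - 0) * \<phi>'' \<eta>"
    using MVT2[of 0 \<xi> \<phi>' \<phi>''] D2 \<xi> by auto
  have "\<bar>h t - h x - \<phi>' 0\<bar> = \<xi> * \<bar>\<phi>'' \<eta>\<bar>"
    using \<xi> \<eta> by (simp add: v_def abs_mult)
  also have "\<dots> \<le> 1 * ((real CARD('p))\<^sup>2 * D * (norm v)\<^sup>2)"
    using \<xi> \<eta> by (intro mult_mono B) auto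
  finally show ?thesis
    by (simp add: \<phi>'_def v_def)
qed

subsection \<open>The linearised likelihood equations\<close>

text \<open>Cauchy-Schwarz in each row, then the l1 bound over the rows. The norm of a matrix is
  here the Frobenius norm, so the dimension factor is crude, but only finiteness of the constant
  matters.\<close>

lemma norm_matrix_vector_mult_le:
  fixes A :: "real ^ 'n::finite ^ 'm::finite"
  shows "norm (A *v x) \<le> real CARD('m) * norm A * norm x"
proof -
  have "norm (A *v x) \<le> (\<Sum>i\<in>UNIV. \<bar>(A *v x) $ i\<bar>)"
    by (rule norm_le_l1_cart)
  also have "\<dots> \<le> (\<Sum>i\<in>(UNIV::'m set). norm A * norm x)"
  proof (rule sum_mono)
    fix i
    have "\<bar>(A *v x) $ i\<bar> \<le> norm (A $ i) * norm x"
      by (simp add: matrix_vector_mul_component Cauchy_Schwarz_ineq2)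
    also have "\<dots> \<le> norm A * norm x"
      by (intro mult_right_mono Finite_Cartesian_Product.norm_nth_le) simp
    finally show "\<bar>(A *v x) $ i\<bar> \<le> norm A * norm x" .
  qed
  finally show ?thesis by simp
qed

lemma positive_definite_imp_invertible:
  fixes H :: "real ^ 'n::finite ^ 'n"
  assumes "positive_definite H"
  shows "invertible H"
proof -
  have "x = 0" if "H *v x = 0" for x
    using assms that unfolding positive_definite_def by (metis inner_zero_right less_irrefl)
  then show ?thesis
    using matrix_left_invertible_ker[of H] invertible_left_inverse[of H] by blast
qed

lemma matrix_inv_mult_vector:
  fixes H :: "real ^ 'n::finite ^ 'n"
  assumes "invertible H"
  shows "H *v (matrix_inv H *v x) = x" "matrix_inv H *v (H *v x) = x"
proof -
  have "H ** matrix_inv H = mat 1 \<and> matrix_inv H ** H = mat 1"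
    using assms unfolding invertible_def matrix_inv_def by (rule someI_ex)
  then show "H *v (matrix_inv H *v x) = x" "matrix_inv H *v (H *v x) = x"
    by (simp_all add: matrix_vector_mul_assoc)
qed

text \<open>For \<open>x\<close> in the kernel, \<open>z = H\<^sup>-\<^sup>1 G x\<close> satisfies
  \<open>z \<bullet> H z = x \<bullet> G\<^sup>T z = 0\<close>. Positive definiteness of
  \<open>H\<close> gives \<open>z = 0\<close>, hence \<open>G x = 0\<close>, and full column rank
  gives \<open>x = 0\<close>. Passing to \<open>z\<close> avoids a separate proof that the inverse
  of \<open>H\<close> is positive definite.\<close>

lemma invertible_transpose_inv_mult:
  fixes H :: "real ^ 'p::finite ^ 'p" and G :: "real ^ 'r::finite ^ 'p"
  assumes H: "positive_definite H" and G: "rank G = CARD('r)"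
  shows "invertible (transpose G ** matrix_inv H ** G)"
proof -
  note inv = matrix_inv_mult_vector[OF positive_definite_imp_invertible[OF H]]
  have "x = 0" if x: "(transpose G ** matrix_inv H ** G) *v x = 0" for x
  proof -
    define z where "z = matrix_inv H *v (G *v x)"
    have Hz: "H *v z = G *v x"
      by (simp add: z_def inv)
    have "z \<bullet> (H *v z) = x \<bullet> (transpose G *v z)"
      unfolding Hz by (metis dot_lmul_matrix inner_commute transpose_matrix_vector)
    also have "\<dots> = 0"
      using x by (simp add: z_def matrix_vector_mul_assoc matrix_mul_assoc del: transpose_matrix_vector)
    finally have "z = 0"
      using H unfolding positive_definite_def by (metis less_irrefl)
    then have "G *v x = G *v 0"
      using Hz by simp
    then show "x = 0"
      using G full_rank_injective[of G] by (metis inj_eq)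
  qed
  then show ?thesis
    using matrix_left_invertible_ker[of "transpose G ** matrix_inv H ** G"]
      invertible_left_inverse[of "transpose G ** matrix_inv H ** G"] by blast
qed

text \<open>
  \<open>H a = s\<close> and \<open>H b = s + G l\<close>, \<open>G\<^sup>T b = 0\<close> are the linearised equations of the two estimators;
  eliminating \<open>s\<close> and the multiplier \<open>l\<close> gives \<open>b = (I + Q G\<^sup>T) a\<close>.
\<close>
lemma linearised_equations_perturbation:
  fixes H :: "real ^ 'p::finite ^ 'p" and G :: "real ^ 'r::finite ^ 'p"
  assumes H: "positive_definite H" and G: "rank G = CARD('r)"
  obtains C \<delta>0 where "C > 0" "\<delta>0 > 0"
    "\<And>\<delta> s a b l e1 e2 e3. \<lbrakk>0 \<le> \<delta>; \<delta> \<le> \<delta>0; H *v a = s + e1; H *v b = s + G *v l + e2;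
        transpose G *v b = e3; norm e1 \<le> \<delta> * norm a; norm e2 \<le> \<delta> * (norm b + norm l);
        norm e3 \<le> \<delta> * norm b\<rbrakk>
      \<Longrightarrow> norm (b - (mat 1 + Q_matrix H G ** transpose G) *v a) \<le> C * \<delta> * norm s"
proof -
  define Hi where "Hi = matrix_inv H"
  define W where "W = matrix_inv (transpose G ** Hi ** G)"
  note invH = matrix_inv_mult_vector[OF positive_definite_imp_invertible[OF H], folded Hi_def]
  note invW = matrix_inv_mult_vector[OF invertible_transpose_inv_mult[OF H G],
      folded Hi_def, folded W_def]
  \<comment> \<open>A single constant for all composites of \<open>Hi\<close>, \<open>G\<close> and
    \<open>W\<close> met below. It is at least 1 so that its powers can be compared, and it is fixed
    before \<delta>.\<close>
  obtain k where "k \<ge> 1" and k1: "norm (Hi *v x) \<le> k * norm x"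
    and k2: "norm (Hi *v (G *v y)) \<le> k * norm y"
    and k3: "norm (W *v y) \<le> k * norm y"
    and k4: "norm (W *v (transpose G *v (Hi *v x))) \<le> k * norm x"
    and k5: "norm (Hi *v (G *v (W *v y))) \<le> k * norm y"
    and k6: "norm (Hi *v (G *v (W *v (transpose G *v (Hi *v x))))) \<le> k * norm x" for x y
  proof -
    define c1 c2 c3 c4 c5 c6 where c_defs: "c1 = real CARD('p) * norm Hi"
      "c2 = real CARD('p) * norm (Hi ** G)" "c3 = real CARD('r) * norm W"
      "c4 = real CARD('r) * norm (W ** (transpose G ** Hi))"
      "c5 = real CARD('p) * norm (Hi ** (G ** W))"
      "c6 = real CARD('p) * norm (Hi ** (G ** (W ** (transpose G ** Hi))))"
    define k where "k = 1 + c1 + c2 + c3 + c4 + c5 + c6"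
    have c: "0 \<le> c1" "0 \<le> c2" "0 \<le> c3" "0 \<le> c4" "0 \<le> c5" "0 \<le> c6"
      by (simp_all add: c_defs)
    have le: "c1 \<le> k" "c2 \<le> k" "c3 \<le> k" "c4 \<le> k" "c5 \<le> k" "c6 \<le> k" "1 \<le> k"
      using c by (simp_all add: k_def)
    show ?thesis
    proof (rule that[OF le(7)])
      fix x :: "real ^ 'p" and y :: "real ^ 'r"
      note mono = order_trans[OF norm_matrix_vector_mult_le mult_right_mono]
      show "norm (Hi *v x) \<le> k * norm x"
        using le by (intro mono) (simp_all add: c_defs)
      have "norm ((Hi ** G) *v y) \<le> k * norm y"
        using le by (intro mono) (simp_all add: c_defs)
      then show "norm (Hi *v (G *v y)) \<le> k * norm y"
        by (simp add: matrix_vector_mul_assoc)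
      show "norm (W *v y) \<le> k * norm y"
        using le by (intro mono) (simp_all add: c_defs)
      have "norm ((W ** (transpose G ** Hi)) *v x) \<le> k * norm x"
        using le by (intro mono) (simp_all add: c_defs)
      then show "norm (W *v (transpose G *v (Hi *v x))) \<le> k * norm x"
        by (simp add: matrix_vector_mul_assoc matrix_mul_assoc)
      have "norm ((Hi ** (G ** W)) *v y) \<le> k * norm y"
        using le by (intro mono) (simp_all add: c_defs)
      then show "norm (Hi *v (G *v (W *v y))) \<le> k * norm y"
        by (simp add: matrix_vector_mul_assoc matrix_mul_assoc)
      have "norm ((Hi ** (G ** (W ** (transpose G ** Hi)))) *v x) \<le> k * norm x"
        using le by (intro mono) (simp_all add: c_defs)
      then show "norm (Hi *v (G *v (W *v (transpose G *v (Hi *v x))))) \<le> k * norm x"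
        by (simp add: matrix_vector_mul_assoc matrix_mul_assoc)
    qed
  qed
  show ?thesis
  \<comment> \<open>The choice of \<open>\<delta>0\<close> gives
    \<open>k\<^sup>2 * \<delta> \<le> 1/10\<close>, small enough to absorb the error terms. The
    number 22 is 3 * 6 + 2 * 2, from inserting the bounds \<open>nz\<close> and \<open>na\<close>
    into the final estimate.\<close>
  proof (rule that[of "22 * k ^ 3" "1 / (10 * k\<^sup>2)"])
    show "22 * k ^ 3 > 0" "1 / (10 * k\<^sup>2) > 0"
      using \<open>k \<ge> 1\<close> by auto
    fix \<delta> :: real and s a b :: "real ^ 'p" and l :: "real ^ 'r" and e1 e2 :: "real ^ 'p" and e3 :: "real ^ 'r"
    assume \<delta>: "0 \<le> \<delta>" "\<delta> \<le> 1 / (10 * k\<^sup>2)"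
      and a: "H *v a = s + e1" and b: "H *v b = s + G *v l + e2" and Gb: "transpose G *v b = e3"
      and e: "norm e1 \<le> \<delta> * norm a" "norm e2 \<le> \<delta> * (norm b + norm l)"
        "norm e3 \<le> \<delta> * norm b"
    define z where "z = norm b + norm l"
    have kk: "k \<le> k\<^sup>2" "k\<^sup>2 \<le> k ^ 3"
      using \<open>k \<ge> 1\<close> by (auto simp: self_le_power intro: power_increasing)
    have dk: "\<delta> * k\<^sup>2 \<le> 1 / 10"
      using \<delta> \<open>k \<ge> 1\<close> by (simp add: field_simps)
    have a': "a = Hi *v s + Hi *v e1"
      using arg_cong[OF a, of "\<lambda>v. Hi *v v"] by (simp add: invH matrix_vector_right_distrib)
    have b': "b = Hi *v s + Hi *v (G *v l) + Hi *v e2"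
      using arg_cong[OF b, of "\<lambda>v. Hi *v v"] by (simp add: invH matrix_vector_right_distrib)
    \<comment> \<open>Applying \<open>W G\<^sup>T\<close> to \<open>b'\<close> isolates the
      multiplier, because \<open>W\<close> inverts \<open>G\<^sup>T Hi G\<close>.\<close>
    have "W *v e3 = W *v (transpose G *v (Hi *v s)) + l + W *v (transpose G *v (Hi *v e2))"
    proof -
      have "W *v e3 = W *v (transpose G *v (Hi *v s)) + W *v (transpose G *v (Hi *v (G *v l)))
          + W *v (transpose G *v (Hi *v e2))"
        unfolding Gb[symmetric] by (subst b') (simp add: matrix_vector_right_distrib)
      moreover have "W *v (transpose G *v (Hi *v (G *v l))) = l"
        using invW(2)[of l] by (simp add: matrix_vector_mul_assoc matrix_mul_assoc)
      ultimately show ?thesis by simp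
    qed
    then have l': "l = W *v e3 - W *v (transpose G *v (Hi *v s)) - W *v (transpose G *v (Hi *v e2))"
      by (simp add: algebra_simps)
    have kd: "0 \<le> k * \<delta>" "k * \<delta> \<le> 1 / 2" "0 \<le> k"
      using \<open>k \<ge> 1\<close> \<delta>(1) dk mult_left_mono[OF kk(1) \<delta>(1)] by (auto simp: mult.commute)
    have ke: "k * norm e1 \<le> k * \<delta> * norm a" "k * norm e2 \<le> k * \<delta> * z" "k * norm e3 \<le> k * \<delta> * norm b"
      using mult_left_mono[OF e(1) kd(3)] mult_left_mono[OF e(2) kd(3)] mult_left_mono[OF e(3) kd(3)]
      by (auto simp: z_def mult.assoc)
    have bz: "norm b \<le> z" "0 \<le> z"
      by (auto simp: z_def)
    have kbz: "k * \<delta> * norm b \<le> k * \<delta> * z"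
      using kd bz by (intro mult_left_mono) auto
    have na: "norm a \<le> 2 * k * norm s"
    proof -
      have "norm a \<le> norm (Hi *v s) + norm (Hi *v e1)"
        by (subst a') (rule norm_triangle_ineq)
      also have "\<dots> \<le> k * norm s + k * \<delta> * norm a"
        using k1[of s] k1[of e1] ke(1) by linarith
      \<comment> \<open>Since \<open>k * \<delta> \<le> 1/2\<close>, half of \<open>norm a\<close>
        moves to the left-hand side.\<close>
      also have "\<dots> \<le> k * norm s + 1 / 2 * norm a"
        using kd by (intro add_left_mono mult_right_mono) auto
      finally show ?thesis by simp
    qed
    have nl: "norm l \<le> k * norm s + 2 * (k * \<delta> * z)"
    proof -
      have "norm l \<le> norm (W *v e3) + norm (W *v (transpose G *v (Hi *v s)))
          + norm (W *v (transpose G *v (Hi *v e2)))"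
        by (subst l') (intro order_trans[OF norm_triangle_ineq4] add_right_mono norm_triangle_ineq4)
      also have "\<dots> \<le> k * norm s + 2 * (k * \<delta> * z)"
        using k3[of e3] k4[of s] k4[of e2] ke kbz by linarith
      finally show ?thesis .
    qed
    have nb: "norm b \<le> k * norm s + k * norm l + k * \<delta> * z"
    proof -
      have "norm b \<le> norm (Hi *v s) + norm (Hi *v (G *v l)) + norm (Hi *v e2)"
        by (subst b') (intro order_trans[OF norm_triangle_ineq] add_right_mono norm_triangle_ineq)
      also have "\<dots> \<le> k * norm s + k * norm l + k * \<delta> * z"
        using k1[of s] k2[of l] k1[of e2] ke(2) by linarith
      finally show ?thesis .
    qed
    \<comment> \<open>The bounds for \<open>b\<close> and \<open>l\<close> refer to each other
      through \<open>z\<close>, so they are added: \<open>z\<close> is at most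
      \<open>3 * k\<^sup>2 * norm s + 5 * k\<^sup>2 * \<delta> * z\<close>, and the last term is at
      most \<open>z / 2\<close>.\<close>
    have nz: "z \<le> 6 * k\<^sup>2 * norm s"
    proof -
      have "k * norm l \<le> k\<^sup>2 * norm s + 2 * (k\<^sup>2 * \<delta> * z)"
        using mult_left_mono[OF nl kd(3)] by (simp add: algebra_simps power2_eq_square)
      moreover have "k * norm s \<le> k\<^sup>2 * norm s"
        using kk by (intro mult_right_mono) auto
      moreover have "k * \<delta> * z \<le> k\<^sup>2 * \<delta> * z"
        using kk \<delta> bz by (intro mult_right_mono) auto
      moreover have "k\<^sup>2 * \<delta> * z \<le> 1 / 10 * z"
        using dk bz by (intro mult_right_mono) (auto simp: mult.commute)
      moreover have "z = norm b + norm l"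
        by (simp add: z_def)
      ultimately show ?thesis
        using nb nl by linarith
    qed
    \<comment> \<open>All terms in \<open>s\<close> cancel:
      \<open>Hi s - Hi G W G\<^sup>T Hi s\<close> occurs both in \<open>b\<close>, after
      substituting \<open>l'\<close>, and in the image of \<open>a\<close>. Only errors remain,
      which yields the factor \<delta>.\<close>
    have "b - (mat 1 + Q_matrix H G ** transpose G) *v a
      = Hi *v (e2 - e1) + Hi *v (G *v (W *v e3)) - Hi *v (G *v (W *v (transpose G *v (Hi *v (e2 - e1)))))"
    proof -
      have minus: "(- A) *v x = - (A *v x)" for A :: "real ^ 'p ^ 'p" and x
        by (simp add: vec_eq_iff matrix_vector_mult_def sum_negf)
      have neg: "- A ** C = - (A ** C)" for A :: "real ^ 'r ^ 'p" and C :: "real ^ 'p ^ 'r"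
        by (simp add: vec_eq_iff matrix_matrix_mult_def sum_negf)
      have "(mat 1 + Q_matrix H G ** transpose G) *v a = a - Hi *v (G *v (W *v (transpose G *v a)))"
        by (simp add: Q_matrix_def Hi_def W_def matrix_vector_mult_diff_rdistrib
            matrix_vector_mul_assoc[symmetric] neg minus
            del: transpose_matrix_vector)
      also have "\<dots> = Hi *v s + Hi *v e1 - (Hi *v (G *v (W *v (transpose G *v (Hi *v s))))
          + Hi *v (G *v (W *v (transpose G *v (Hi *v e1)))))"
        by (subst (1 2) a') (simp add: matrix_vector_right_distrib)
      finally show ?thesis
        by (subst b', subst l')
          (simp add: matrix_vector_right_distrib matrix_vector_mult_diff_distrib)
    qed
    also have "norm \<dots> \<le> norm (Hi *v (e2 - e1)) + norm (Hi *v (G *v (W *v e3)))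
        + norm (Hi *v (G *v (W *v (transpose G *v (Hi *v (e2 - e1))))))"
      by (intro order_trans[OF norm_triangle_ineq4] add_right_mono norm_triangle_ineq)
    also have "\<dots> \<le> 2 * (k * norm (e2 - e1)) + k * norm e3"
      using k1[of "e2 - e1"] k5[of e3] k6[of "e2 - e1"] by linarith
    also have "\<dots> \<le> 2 * (k * (norm e2 + norm e1)) + k * norm e3"
      using kd(3) by (intro add_right_mono mult_left_mono norm_triangle_ineq4) auto
    also have "\<dots> \<le> 3 * (k * \<delta> * z) + 2 * (k * \<delta> * norm a)"
      using ke kbz by (simp add: algebra_simps)
    also have "\<dots> \<le> 3 * (k * \<delta> * (6 * k\<^sup>2 * norm s)) + 2 * (k * \<delta> * (2 * k * norm s))"
      using kd nz na by (intro add_mono mult_left_mono) auto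
    also have "\<dots> = 18 * k ^ 3 * \<delta> * norm s + 4 * k\<^sup>2 * (\<delta> * norm s)"
      by (simp add: power3_eq_cube power2_eq_square algebra_simps)
    also have "\<dots> \<le> 18 * k ^ 3 * \<delta> * norm s + 4 * k ^ 3 * (\<delta> * norm s)"
      using kk \<delta> by (intro add_left_mono mult_right_mono) auto
    finally show "norm (b - (mat 1 + Q_matrix H G ** transpose G) *v a) \<le> 22 * k ^ 3 * \<delta> * norm s"
      by (simp add: mult_ac)
  qed
qed

subsection \<open>Events with probability tending to 1\<close>

context prob_space
begin

lemma with_prob_tending_to_1_mono:
  assumes "with_prob_tending_to_1 M Q" "\<And>n \<omega>. Q n \<omega> \<Longrightarrow> R n \<omega>"
  shows "with_prob_tending_to_1 M R"
  using assms unfolding with_prob_tending_to_1_def by blast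

text \<open>Exceptional sets are easier to combine than good ones: conjunctions become unions, and
  subadditivity of the measure applies.\<close>

lemma with_prob_tending_to_1_iff_compl:
  "with_prob_tending_to_1 M Q \<longleftrightarrow>
    (\<exists>F. (\<forall>n. F n \<in> events \<and> (\<forall>\<omega>\<in>space M - F n. Q n \<omega>)) \<and> (\<lambda>n. prob (F n)) \<longlonglongrightarrow> 0)"
proof
  assume "with_prob_tending_to_1 M Q"
  then obtain E where E: "\<And>n. E n \<in> events" "\<And>n \<omega>. \<omega> \<in> E n \<Longrightarrow> Q n \<omega>" "(\<lambda>n. prob (E n)) \<longlonglongrightarrow> 1"
    unfolding with_prob_tending_to_1_def by blast
  have "(\<lambda>n. 1 - prob (E n)) \<longlonglongrightarrow> 1 - 1"
    by (intro tendsto_intros E)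
  then have "(\<lambda>n. prob (space M - E n)) \<longlonglongrightarrow> 0"
    using E(1) by (simp add: prob_compl)
  then show "\<exists>F. (\<forall>n. F n \<in> events \<and> (\<forall>\<omega>\<in>space M - F n. Q n \<omega>)) \<and> (\<lambda>n. prob (F n)) \<longlonglongrightarrow> 0"
    using E by (intro exI[of _ "\<lambda>n. space M - E n"]) auto
next
  assume "\<exists>F. (\<forall>n. F n \<in> events \<and> (\<forall>\<omega>\<in>space M - F n. Q n \<omega>)) \<and> (\<lambda>n. prob (F n)) \<longlonglongrightarrow> 0"
  then obtain F where F: "\<And>n. F n \<in> events" "\<And>n \<omega>. \<omega> \<in> space M - F n \<Longrightarrow> Q n \<omega>"
    "(\<lambda>n. prob (F n)) \<longlonglongrightarrow> 0"
    by blast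
  have "(\<lambda>n. 1 - prob (F n)) \<longlonglongrightarrow> 1 - 0"
    by (intro tendsto_intros F)
  then have "(\<lambda>n. prob (space M - F n)) \<longlonglongrightarrow> 1"
    using F(1) by (simp add: prob_compl)
  then show "with_prob_tending_to_1 M Q"
    unfolding with_prob_tending_to_1_def
    using F by (intro exI[of _ "\<lambda>n. space M - F n"]) auto
qed

lemma with_prob_tending_to_1_conj:
  assumes "with_prob_tending_to_1 M Q" "with_prob_tending_to_1 M R"
  shows "with_prob_tending_to_1 M (\<lambda>n \<omega>. Q n \<omega> \<and> R n \<omega>)"
proof -
  obtain F where F: "\<And>n. F n \<in> events" "\<And>n \<omega>. \<omega> \<in> space M - F n \<Longrightarrow> Q n \<omega>"
    "(\<lambda>n. prob (F n)) \<longlonglongrightarrow> 0"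
    using assms(1) unfolding with_prob_tending_to_1_iff_compl by blast
  obtain F' where F': "\<And>n. F' n \<in> events" "\<And>n \<omega>. \<omega> \<in> space M - F' n \<Longrightarrow> R n \<omega>"
    "(\<lambda>n. prob (F' n)) \<longlonglongrightarrow> 0"
    using assms(2) unfolding with_prob_tending_to_1_iff_compl by blast
  have "(\<lambda>n. prob (F n) + prob (F' n)) \<longlonglongrightarrow> 0"
    using tendsto_add[OF F(3) F'(3)] by simp
  then have "(\<lambda>n. prob (F n \<union> F' n)) \<longlonglongrightarrow> 0"
    by (rule tendsto_sandwich[OF _ _ tendsto_const, rotated -1])
      (auto intro!: always_eventually measure_Un_le F F')
  then show ?thesis
    unfolding with_prob_tending_to_1_iff_compl using F F' by (intro exI[of _ "\<lambda>n. F n \<union> F' n"]) auto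
qed

lemma with_prob_tending_to_1_all_finite:
  assumes "\<And>i::'i::finite. with_prob_tending_to_1 M (Q i)"
  shows "with_prob_tending_to_1 M (\<lambda>n \<omega>. \<forall>i. Q i n \<omega>)"
proof -
  have "with_prob_tending_to_1 M (\<lambda>n \<omega>. \<forall>i\<in>I. Q i n \<omega>)" if "finite I" for I :: "'i set"
    using that
  proof induction
    case empty
    show ?case
      unfolding with_prob_tending_to_1_iff_compl by (intro exI[of _ "\<lambda>_. {}"]) auto
  next
    case (insert i I)
    show ?case
      using with_prob_tending_to_1_conj[OF assms insert.IH] by simp
  qed
  from this[of UNIV] show ?thesis by simp
qed

text \<open>One measurable null set serves as the exceptional set for every
  \<open>n\<close>.\<close>

lemma with_prob_tending_to_1_AE:
  assumes "AE \<omega> in M. \<forall>n. Q n \<omega>"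
  shows "with_prob_tending_to_1 M Q"
proof -
  from assms obtain F where F: "{\<omega> \<in> space M. \<not> (\<forall>n. Q n \<omega>)} \<subseteq> F" "emeasure M F = 0" "F \<in> events"
    by (rule AE_E)
  show ?thesis
    unfolding with_prob_tending_to_1_iff_compl
    by (intro exI[of _ "\<lambda>_. F"]) (use F in \<open>auto simp: measure_def\<close>)
qed

lemma with_prob_tending_to_1_tendsto_in_prob:
  fixes X :: "nat \<Rightarrow> 'a \<Rightarrow> 'b::{second_countable_topology, metric_space}"
  assumes [measurable]: "\<And>n. X n \<in> borel_measurable M" and "tendsto_in_prob M X c" "e > 0"
  shows "with_prob_tending_to_1 M (\<lambda>n \<omega>. dist (X n \<omega>) c \<le> e)"
  unfolding with_prob_tending_to_1_iff_compl
  using assms by (intro exI[of _ "\<lambda>n. {\<omega> \<in> space M. dist (X n \<omega>) c > e}"])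
    (auto simp: tendsto_in_prob_def not_less)

lemma with_prob_tending_to_1_eventually:
  assumes "eventually Q sequentially"
  shows "with_prob_tending_to_1 M (\<lambda>n \<omega>. Q n)"
proof -
  have "(\<lambda>n. prob (if Q n then space M else {})) \<longlonglongrightarrow> 1"
    by (rule tendsto_eventually) (use assms in eventually_elim, simp add: prob_space)
  then show ?thesis
    unfolding with_prob_tending_to_1_def
    by (intro exI[of _ "\<lambda>n. if Q n then space M else {}"]) (auto split: if_splits)
qed

text \<open>Tightness first supplies a level \<open>b\<close> that \<open>S n\<close> exceeds with
  probability at most \<open>\<eta> / 2\<close>. Only then is \<delta> chosen, with
  \<open>\<delta> * b \<le> e\<close>, so that a norm of \<open>X n\<close> above \<open>e\<close>
  forces either \<open>S n > b\<close> or the exceptional event for \<delta>.\<close>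

lemma o_P_1_tight_product:
  fixes X :: "nat \<Rightarrow> 'a \<Rightarrow> 'b::{second_countable_topology, real_normed_vector}"
  assumes [measurable]: "\<And>n. X n \<in> borel_measurable M" "\<And>n. S n \<in> borel_measurable M"
    and tight: "\<And>\<eta>. \<eta> > 0 \<Longrightarrow> \<exists>b>0. \<forall>n. prob {\<omega> \<in> space M. S n \<omega> > b} \<le> \<eta>"
    and bound: "\<delta>0 > 0" "\<And>\<delta>. 0 < \<delta> \<Longrightarrow> \<delta> \<le> \<delta>0 \<Longrightarrow>
      with_prob_tending_to_1 M (\<lambda>n \<omega>. norm (X n \<omega>) \<le> \<delta> * S n \<omega>)"
  shows "o_P_1 M X"
  unfolding o_P_1_def tendsto_in_prob_def
proof (intro allI impI)
  fix e :: real assume "e > 0"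
  show "(\<lambda>n. prob {\<omega> \<in> space M. dist (X n \<omega>) 0 > e}) \<longlonglongrightarrow> 0"
  proof (rule order_tendstoI)
    fix a :: real assume "a < 0"
    then show "eventually (\<lambda>n. prob {\<omega> \<in> space M. dist (X n \<omega>) 0 > e} > a) sequentially"
      by (intro always_eventually allI less_le_trans[OF _ measure_nonneg])
  next
    fix \<eta> :: real assume "0 < \<eta>"
    then obtain b where b: "b > 0" "\<And>n. prob {\<omega> \<in> space M. S n \<omega> > b} \<le> \<eta> / 2"
      using tight[of "\<eta> / 2"] by auto
    define \<delta> where "\<delta> = min \<delta>0 (e / b)"
    have \<delta>: "0 < \<delta>" "\<delta> \<le> \<delta>0" "\<delta> * b \<le> e"
      using b \<open>e > 0\<close> bound(1) by (auto simp: \<delta>_def min_def field_simps)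
    obtain F where F: "\<And>n. F n \<in> events" "(\<lambda>n. prob (F n)) \<longlonglongrightarrow> 0"
      "\<And>n \<omega>. \<omega> \<in> space M - F n \<Longrightarrow> norm (X n \<omega>) \<le> \<delta> * S n \<omega>"
      using bound(2)[OF \<delta>(1,2)] unfolding with_prob_tending_to_1_iff_compl by blast
    have "eventually (\<lambda>n. prob (F n) < \<eta> / 2) sequentially"
      using F(2) \<open>\<eta> > 0\<close> by (intro order_tendstoD) auto
    then show "eventually (\<lambda>n. prob {\<omega> \<in> space M. dist (X n \<omega>) 0 > e} < \<eta>) sequentially"
    proof eventually_elim
      case (elim n)
      have "{\<omega> \<in> space M. dist (X n \<omega>) 0 > e} \<subseteq> F n \<union> {\<omega> \<in> space M. S n \<omega> > b}"
      proof (rule subsetI, rule ccontr)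
        fix \<omega>
        assume \<omega>: "\<omega> \<in> {\<omega> \<in> space M. dist (X n \<omega>) 0 > e}"
          and "\<omega> \<notin> F n \<union> {\<omega> \<in> space M. S n \<omega> > b}"
        then have \<omega>': "\<omega> \<in> space M - F n" "S n \<omega> \<le> b"
          by auto
        have "norm (X n \<omega>) \<le> \<delta> * S n \<omega>"
          by (rule F(3)[OF \<omega>'(1)])
        also have "\<dots> \<le> \<delta> * b"
          using \<delta> \<omega>' by (intro mult_left_mono) auto
        finally show False
          using \<delta> \<omega> by simp
      qed
      then have "prob {\<omega> \<in> space M. dist (X n \<omega>) 0 > e} \<le> prob (F n \<union> {\<omega> \<in> space M. S n \<omega> > b})"
        using F(1) by (intro finite_measure_mono) auto
      also have "\<dots> \<le> prob (F n) + prob {\<omega> \<in> space M. S n \<omega> > b}"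
        using F(1) by (intro measure_Un_le) auto
      finally show ?case
        using elim b(2)[of n] by simp
    qed
  qed
qed

text \<open>The expanded square is a double sum whose off-diagonal expectations vanish, by
  independence of each pair and zero means.\<close>

lemma indep_centered_sum_second_moment:
  fixes X :: "nat \<Rightarrow> 'a \<Rightarrow> real"
  assumes indep: "indep_vars (\<lambda>_. borel) X UNIV"
    and int: "\<And>i. integrable M (X i)" "\<And>i. integrable M (\<lambda>\<omega>. (X i \<omega>)\<^sup>2)"
    and mean: "\<And>i. expectation (X i) = 0" and sq: "\<And>i. expectation (\<lambda>\<omega>. (X i \<omega>)\<^sup>2) = v"
  shows "integrable M (\<lambda>\<omega>. (\<Sum>i<n. X i \<omega>)\<^sup>2)"
    and "expectation (\<lambda>\<omega>. (\<Sum>i<n. X i \<omega>)\<^sup>2) = real n * v"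
proof -
  have pair: "indep_vars (\<lambda>_. borel) X {i, j}" for i j
    by (rule indep_vars_subset[OF indep]) auto
  \<comment> \<open>For \<open>i = j\<close> the set \<open>{i, j}\<close> is a singleton and the
    product over it is just \<open>X i\<close>, so the diagonal is taken from the second-moment
    assumption.\<close>
  have int2: "integrable M (\<lambda>\<omega>. X i \<omega> * X j \<omega>)" for i j
    using indep_vars_integrable[OF _ pair int(1), of i j] int(2)[of i]
    by (cases "i = j") (auto simp: power2_eq_square)
  have E2: "expectation (\<lambda>\<omega>. X i \<omega> * X j \<omega>) = (if i = j then v else 0)" for i j
    using indep_vars_lebesgue_integral[OF _ pair int(1), of i j] sq[of i] mean
    by (cases "i = j") (auto simp: power2_eq_square)
  have eq: "(\<Sum>i<n. X i \<omega>)\<^sup>2 = (\<Sum>i<n. \<Sum>j<n. X i \<omega> * X j \<omega>)" for \<omega>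
    by (simp add: power2_eq_square sum_product)
  show "integrable M (\<lambda>\<omega>. (\<Sum>i<n. X i \<omega>)\<^sup>2)"
    unfolding eq by (intro Bochner_Integration.integrable_sum int2)
  show "expectation (\<lambda>\<omega>. (\<Sum>i<n. X i \<omega>)\<^sup>2) = real n * v"
    unfolding eq by (simp add: Bochner_Integration.integral_sum int2 E2)
qed

end

subsection \<open>Sums of independent identically distributed variables\<close>

text \<open>Moments are assumed on the common law \<open>\<mu>\<close>, the form in which the
  regularity assumptions give them, and are pulled back along \<open>Y i\<close>.\<close>

lemma (in prob_space) iid_centered_sum_second_moment:
  fixes h :: "'b \<Rightarrow> real"
  assumes indep: "indep_vars (\<lambda>_. N) Y UNIV" and ident: "\<And>i. distr M N (Y i) = \<mu>"
    and h: "integrable \<mu> h" "(LINT y|\<mu>. h y) = 0" "integrable \<mu> (\<lambda>y. (h y)\<^sup>2)"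
  shows "integrable M (\<lambda>\<omega>. (\<Sum>i<n. h (Y i \<omega>))\<^sup>2)"
    and "expectation (\<lambda>\<omega>. (\<Sum>i<n. h (Y i \<omega>))\<^sup>2) = real n * (LINT y|\<mu>. (h y)\<^sup>2)"
proof -
  have Y[measurable]: "Y i \<in> measurable M N" for i
    using indep by (auto simp: indep_vars_def)
  have "sets \<mu> = sets N"
    using ident[of 0] by (metis sets_distr)
  with h(1) have meas[measurable]: "h \<in> borel_measurable N"
    by (metis borel_measurable_integrable measurable_cong_sets)
  have int: "integrable M (\<lambda>\<omega>. h (Y i \<omega>))" "integrable M (\<lambda>\<omega>. (h (Y i \<omega>))\<^sup>2)" for i
    using h(1,3) unfolding ident[of i, symmetric]
    by (auto intro: integrable_distr[of "Y i" M N h] integrable_distr[of "Y i" M N "\<lambda>y. (h y)\<^sup>2"])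
  have E: "expectation (\<lambda>\<omega>. h (Y i \<omega>)) = 0"
    "expectation (\<lambda>\<omega>. (h (Y i \<omega>))\<^sup>2) = (LINT y|\<mu>. (h y)\<^sup>2)" for i
    using h(2) unfolding ident[of i, symmetric] by (auto simp: integral_distr)
  have "indep_vars (\<lambda>_. borel) (\<lambda>i \<omega>. h (Y i \<omega>)) UNIV"
    by (rule indep_vars_compose2[OF indep]) simp
  from indep_centered_sum_second_moment[OF this int E]
  show "integrable M (\<lambda>\<omega>. (\<Sum>i<n. h (Y i \<omega>))\<^sup>2)"
    and "expectation (\<lambda>\<omega>. (\<Sum>i<n. h (Y i \<omega>))\<^sup>2) = real n * (LINT y|\<mu>. (h y)\<^sup>2)" .
qed

text \<open>At each point the tail vanishes once \<open>real c\<close> reaches the absolute value of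
  \<open>h\<close>, which is itself an integrable majorant; dominated convergence applies.\<close>

lemma integral_abs_tail_tendsto_0:
  fixes h :: "'b \<Rightarrow> real"
  assumes h[measurable]: "integrable \<mu> h"
  shows "(\<lambda>c. LINT y|\<mu>. \<bar>if \<bar>h y\<bar> \<le> real c then 0 else h y\<bar>) \<longlonglongrightarrow> 0"
proof -
  have [measurable]: "h \<in> borel_measurable \<mu>"
    using h by auto
  have "(\<lambda>c. LINT y|\<mu>. \<bar>if \<bar>h y\<bar> \<le> real c then 0 else h y\<bar>) \<longlonglongrightarrow> (LINT y|\<mu>. 0)"
  proof (rule integral_dominated_convergence[where w = "\<lambda>y. \<bar>h y\<bar>"])
    show "AE y in \<mu>. (\<lambda>c. \<bar>if \<bar>h y\<bar> \<le> real c then 0 else h y\<bar>) \<longlonglongrightarrow> 0"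
    proof (intro AE_I2 tendsto_eventually)
      fix y
      obtain k where "\<bar>h y\<bar> \<le> real k"
        using real_arch_simple by blast
      then show "eventually (\<lambda>c. \<bar>if \<bar>h y\<bar> \<le> real c then 0 else h y\<bar> = 0) sequentially"
        by (intro eventually_sequentiallyI[of k]) auto
    qed
  qed (use h in auto)
  then show ?thesis by simp
qed

lemma (in prob_space) weak_law_of_large_numbers:
  fixes h :: "'b \<Rightarrow> real"
  assumes indep: "indep_vars (\<lambda>_. N) Y UNIV" and ident: "\<And>i. distr M N (Y i) = \<mu>"
    and h: "integrable \<mu> h"
  shows "tendsto_in_prob M (\<lambda>n \<omega>. (\<Sum>i<n. h (Y i \<omega>)) / real n) (LINT y|\<mu>. h y)"
  unfolding tendsto_in_prob_def
proof (intro allI impI)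
  fix e :: real assume e: "e > 0"
  define m where "m = (LINT y|\<mu>. h y)"
  have Y[measurable]: "Y i \<in> measurable M N" for i
    using indep by (auto simp: indep_vars_def)
  have sets: "sets \<mu> = sets N"
    using ident[of 0] by (metis sets_distr)
  with h have [measurable]: "h \<in> borel_measurable N"
    by (metis borel_measurable_integrable measurable_cong_sets)
  have [measurable]: "h \<in> borel_measurable \<mu>"
    using h by auto
  interpret \<mu>: prob_space \<mu>
    unfolding ident[of 0, symmetric] by (rule prob_space_distr) simp
  show "(\<lambda>n. prob {\<omega> \<in> space M. dist ((\<Sum>i<n. h (Y i \<omega>)) / real n) m > e}) \<longlonglongrightarrow> 0"
  proof (rule order_tendstoI)
    fix a :: real assume "a < 0"
    then show "eventually (\<lambda>n. prob {\<omega> \<in> space M. dist ((\<Sum>i<n. h (Y i \<omega>)) / real n) m > e} > a) sequentially"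
      by (intro always_eventually allI less_le_trans[OF _ measure_nonneg])
  next
    fix \<eta> :: real assume \<eta>: "0 < \<eta>"
    \<comment> \<open>The bound \<open>e / 3\<close> controls the mean of the tail; the bound
      \<open>\<eta> * e / 9\<close> makes the Markov quotient \<open>d / (e / 3)\<close> at most
      \<open>\<eta> / 3\<close>.\<close>
    define d where "d = min (e / 3) (\<eta> * e / 9)"
    have d: "d > 0" "d \<le> e / 3" "d \<le> \<eta> * e / 9"
      using e \<eta> by (auto simp: d_def)
    obtain c where c: "(LINT y|\<mu>. \<bar>if \<bar>h y\<bar> \<le> real c then 0 else h y\<bar>) < d"
      using order_tendstoD(2)[OF integral_abs_tail_tendsto_0[OF h] d(1)]
      by (auto simp: eventually_sequentially)
    define tail where "tail y = (if \<bar>h y\<bar> \<le> real c then 0 else h y)" for y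
    define trunc where "trunc y = (if \<bar>h y\<bar> \<le> real c then h y else 0)" for y
    have [measurable]: "tail \<in> borel_measurable N" "trunc \<in> borel_measurable N"
      "tail \<in> borel_measurable \<mu>" "trunc \<in> borel_measurable \<mu>"
      unfolding tail_def[abs_def] trunc_def[abs_def] by measurable
    have split: "h y = trunc y + tail y" for y
      by (simp add: tail_def trunc_def)
    have int_tail: "integrable \<mu> tail" and int_trunc: "integrable \<mu> trunc"
      using h by (auto intro!: Bochner_Integration.integrable_bound[OF h] simp: tail_def trunc_def)
    define t where "t = (LINT y|\<mu>. trunc y)"
    define v where "v = (LINT y|\<mu>. (trunc y - t)\<^sup>2)"
    have m: "m = t + (LINT y|\<mu>. tail y)"
      unfolding m_def t_def split using int_tail int_trunc by simp
    have tail_d: "(LINT y|\<mu>. \<bar>tail y\<bar>) < d"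
      using c unfolding tail_def[symmetric] .
    have tail_e: "\<bar>LINT y|\<mu>. tail y\<bar> < e / 3"
      using integral_norm_bound[of \<mu> tail] tail_d d(2) unfolding real_norm_def by linarith
    have sq: "integrable \<mu> (\<lambda>y. (trunc y - t)\<^sup>2)"
    proof (rule \<mu>.integrable_const_bound)
      have "(trunc y - t)\<^sup>2 \<le> (real c + \<bar>t\<bar>)\<^sup>2" for y
        by (rule abs_le_square_iff[THEN iffD1]) (auto simp: trunc_def)
      then show "AE y in \<mu>. norm ((trunc y - t)\<^sup>2) \<le> (real c + \<bar>t\<bar>)\<^sup>2"
        by simp
    qed simp
    have centred: "integrable \<mu> (\<lambda>y. trunc y - t)" "(LINT y|\<mu>. trunc y - t) = 0"
      using int_trunc by (auto simp: t_def \<mu>.prob_space)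
    note moment = iid_centered_sum_second_moment[OF indep ident centred sq, folded v_def]
    define U where "U n \<omega> = (\<Sum>i<n. trunc (Y i \<omega>) - t) / real n" for n \<omega>
    define R where "R n \<omega> = (\<Sum>i<n. \<bar>tail (Y i \<omega>)\<bar>) / real n" for n \<omega>
    have [measurable]: "U n \<in> borel_measurable M" "R n \<in> borel_measurable M" for n
      unfolding U_def R_def by measurable
    have PU: "prob {\<omega> \<in> space M. (U n \<omega>)\<^sup>2 \<ge> (e / 3)\<^sup>2} \<le> v * (9 / e\<^sup>2) * inverse (real n)" for n
    proof -
      have "expectation (\<lambda>\<omega>. (U n \<omega>)\<^sup>2) = real n * v / (real n)\<^sup>2"
        unfolding U_def power_divide using moment by simp
      moreover have "prob {\<omega> \<in> space M. (U n \<omega>)\<^sup>2 \<ge> (e / 3)\<^sup>2} \<le> expectation (\<lambda>\<omega>. (U n \<omega>)\<^sup>2) / (e / 3)\<^sup>2"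
        using e moment(1)[of n] unfolding U_def power_divide
        by (intro integral_Markov_inequality_measure[of _ _ "{}"]) auto
      ultimately have "prob {\<omega> \<in> space M. (U n \<omega>)\<^sup>2 \<ge> (e / 3)\<^sup>2} \<le> real n * v / (real n)\<^sup>2 / (e / 3)\<^sup>2"
        by simp
      also have "\<dots> = v * (9 / e\<^sup>2) * inverse (real n)"
        \<comment> \<open>At \<open>n = 0\<close> both sides are 0, since division by 0 and
          \<open>inverse 0\<close> are 0.\<close>
        using e by (cases "n = 0") (simp_all add: power2_eq_square field_simps)
      finally show ?thesis .
    qed
    have PR: "prob {\<omega> \<in> space M. R n \<omega> \<ge> e / 3} \<le> \<eta> / 3" for n
    proof -
      have int: "integrable M (\<lambda>\<omega>. \<bar>tail (Y i \<omega>)\<bar>)"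
        and E: "expectation (\<lambda>\<omega>. \<bar>tail (Y i \<omega>)\<bar>) = (LINT y|\<mu>. \<bar>tail y\<bar>)" for i
        using int_tail unfolding ident[of i, symmetric]
        by (auto simp: integral_distr integrable_distr_eq)
      have "expectation (R n) = real n * (LINT y|\<mu>. \<bar>tail y\<bar>) / real n"
        unfolding R_def[abs_def] using int by (simp add: Bochner_Integration.integral_sum E)
      also have "\<dots> \<le> (LINT y|\<mu>. \<bar>tail y\<bar>)"
        by (cases "n = 0") (auto intro!: integral_nonneg_AE)
      finally have "expectation (R n) / (e / 3) \<le> d / (e / 3)"
        using tail_d e by (intro divide_right_mono) auto
      moreover have "prob {\<omega> \<in> space M. R n \<omega> \<ge> e / 3} \<le> expectation (R n) / (e / 3)"
        using e int unfolding R_def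
        by (intro integral_Markov_inequality_measure[of _ _ "{}"]) (auto intro!: sum_nonneg divide_nonneg_nonneg)
      ultimately have "prob {\<omega> \<in> space M. R n \<omega> \<ge> e / 3} \<le> d / (e / 3)"
        by linarith
      also have "\<dots> \<le> (\<eta> * e / 9) / (e / 3)"
        using d e by (intro divide_right_mono) auto
      finally show ?thesis
        using e by simp
    qed
    have "(\<lambda>n. v * (9 / e\<^sup>2) * inverse (real n)) \<longlonglongrightarrow> v * (9 / e\<^sup>2) * 0"
      by (intro tendsto_intros LIMSEQ_inverse_real_of_nat_add lim_inverse_n)
    then have "eventually (\<lambda>n. v * (9 / e\<^sup>2) * inverse (real n) < \<eta> / 3) sequentially"
      using \<eta> by (intro order_tendstoD(2)) auto
    then show "eventually (\<lambda>n. prob {\<omega> \<in> space M. dist ((\<Sum>i<n. h (Y i \<omega>)) / real n) m > e} < \<eta>) sequentially"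
      using eventually_gt_at_top[of 0]
    proof eventually_elim
      case (elim n)
      have "{\<omega> \<in> space M. dist ((\<Sum>i<n. h (Y i \<omega>)) / real n) m > e}
        \<subseteq> {\<omega> \<in> space M. (U n \<omega>)\<^sup>2 \<ge> (e / 3)\<^sup>2} \<union> {\<omega> \<in> space M. R n \<omega> \<ge> e / 3}"
      proof (rule subsetI, rule ccontr)
        fix \<omega> assume \<omega>: "\<omega> \<in> {\<omega> \<in> space M. dist ((\<Sum>i<n. h (Y i \<omega>)) / real n) m > e}"
          and "\<omega> \<notin> {\<omega> \<in> space M. (U n \<omega>)\<^sup>2 \<ge> (e / 3)\<^sup>2} \<union> {\<omega> \<in> space M. R n \<omega> \<ge> e / 3}"
        then have "(U n \<omega>)\<^sup>2 < (e / 3)\<^sup>2" and R: "R n \<omega> < e / 3"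
          by auto
        then have U: "\<bar>U n \<omega>\<bar> < e / 3"
          using e power_less_imp_less_base[of "\<bar>U n \<omega>\<bar>" 2 "e / 3"] by simp
        \<comment> \<open>The deviation has three parts: centred truncated average, tail average,
          and tail mean. Each is below \<open>e / 3\<close> in absolute value.\<close>
        have "(\<Sum>i<n. h (Y i \<omega>)) / real n - m
            = U n \<omega> + (\<Sum>i<n. tail (Y i \<omega>)) / real n - (LINT y|\<mu>. tail y)"
          using elim(2) by (simp add: split U_def m sum.distrib sum_subtractf field_simps)
        moreover have "\<bar>(\<Sum>i<n. tail (Y i \<omega>)) / real n\<bar> \<le> R n \<omega>"
          unfolding R_def abs_divide by (auto intro!: divide_right_mono sum_abs)
        ultimately have "dist ((\<Sum>i<n. h (Y i \<omega>)) / real n) m < e"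
          using U R tail_e unfolding dist_real_def by linarith
        with \<omega> show False by simp
      qed
      then have "prob {\<omega> \<in> space M. dist ((\<Sum>i<n. h (Y i \<omega>)) / real n) m > e}
        \<le> prob ({\<omega> \<in> space M. (U n \<omega>)\<^sup>2 \<ge> (e / 3)\<^sup>2} \<union> {\<omega> \<in> space M. R n \<omega> \<ge> e / 3})"
        by (intro finite_measure_mono) auto
      also have "\<dots> \<le> prob {\<omega> \<in> space M. (U n \<omega>)\<^sup>2 \<ge> (e / 3)\<^sup>2} + prob {\<omega> \<in> space M. R n \<omega> \<ge> e / 3}"
        by (intro measure_Un_le) auto
      finally show ?case
        using PU[of n] PR[of n] elim(1) \<eta> by linarith
    qed
  qed
qed

text \<open>The factor \<open>1 / sqrt n\<close> makes the second moment of the norm bounded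
  uniformly in \<open>n\<close>, and Markov's inequality for the squared norm concludes.\<close>

lemma (in prob_space) normalised_sum_tight:
  fixes u :: "'b \<Rightarrow> real ^ 'p::finite"
  assumes indep: "indep_vars (\<lambda>_. N) Y UNIV" and ident: "\<And>i. distr M N (Y i) = \<mu>"
    and u: "\<And>j. integrable \<mu> (\<lambda>y. u y $ j)" "\<And>j. (LINT y|\<mu>. u y $ j) = 0"
      "\<And>j. integrable \<mu> (\<lambda>y. (u y $ j)\<^sup>2)"
    and "\<eta> > 0"
  shows "\<exists>b>0. \<forall>n. prob {\<omega> \<in> space M. norm ((1 / sqrt (real n)) *\<^sub>R (\<Sum>i<n. u (Y i \<omega>))) > b} \<le> \<eta>"
proof -
  define v where "v = (\<Sum>j\<in>UNIV. LINT y|\<mu>. (u y $ j)\<^sup>2)"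
  define S where "S n \<omega> = norm ((1 / sqrt (real n)) *\<^sub>R (\<Sum>i<n. u (Y i \<omega>)))" for n \<omega>
  note moment = iid_centered_sum_second_moment[OF indep ident u]
  have S2: "(S n \<omega>)\<^sup>2 = (\<Sum>j\<in>UNIV. (\<Sum>i<n. u (Y i \<omega>) $ j)\<^sup>2) / real n" for n \<omega>
    by (simp add: S_def power_mult_distrib power_divide norm_vec_def L2_set_def sum_nonneg
        flip: sum_divide_distrib)
  have int: "integrable M (\<lambda>\<omega>. (S n \<omega>)\<^sup>2)" for n
    unfolding S2 using moment(1) by (intro integrable_divide_zero Bochner_Integration.integrable_sum) auto
  have "v \<ge> 0"
    unfolding v_def by (intro sum_nonneg integral_nonneg_AE) auto
  have "expectation (\<lambda>\<omega>. (S n \<omega>)\<^sup>2) = real n * v / real n" for n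
    unfolding S2 v_def using moment
    by (simp add: Bochner_Integration.integral_sum sum_distrib_left)
  \<comment> \<open>An inequality because of \<open>n = 0\<close>, where the expectation is 0
    instead of \<open>v\<close>.\<close>
  then have E: "expectation (\<lambda>\<omega>. (S n \<omega>)\<^sup>2) \<le> v" for n
    using \<open>v \<ge> 0\<close> by (cases "n = 0") auto
  \<comment> \<open>Adding 1 keeps \<open>b\<close> positive when \<open>v = 0\<close>.\<close>
  define b where "b = sqrt ((v + 1) / \<eta>)"
  have b: "b > 0" "b\<^sup>2 = (v + 1) / \<eta>"
    using \<open>v \<ge> 0\<close> \<open>\<eta> > 0\<close> by (auto simp: b_def)
  have "prob {\<omega> \<in> space M. S n \<omega> > b} \<le> \<eta>" for n
  proof -
    have [measurable]: "(\<lambda>\<omega>. (S n \<omega>)\<^sup>2) \<in> borel_measurable M"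
      using int by auto
    have "prob {\<omega> \<in> space M. S n \<omega> > b} \<le> prob {\<omega> \<in> space M. (S n \<omega>)\<^sup>2 \<ge> b\<^sup>2}"
      using b(1) by (intro finite_measure_mono) (auto intro!: power_mono)
    also have "\<dots> \<le> expectation (\<lambda>\<omega>. (S n \<omega>)\<^sup>2) / b\<^sup>2"
      using b(1) int by (intro integral_Markov_inequality_measure[of _ _ "{}"]) auto
    also have "\<dots> \<le> v / b\<^sup>2"
      by (intro divide_right_mono E) simp
    also have "\<dots> \<le> \<eta>"
      using \<open>v \<ge> 0\<close> \<open>\<eta> > 0\<close> unfolding b by (simp add: field_simps)
    finally show ?thesis .
  qed
  with b(1) show ?thesis
    unfolding S_def by auto
qed

subsection \<open>Expansion of the score and of the estimators\<close>

text \<open>A deterministic statement about one fixed sample. Each score component is expanded at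
  \<theta> and the expansions are averaged: the averaged derivative differs from \<open>- H\<close>
  by at most \<eta> per entry, and the averaged remainder is quadratic in
  \<open>t - \<theta>\<close> with coefficient \<open>c\<^sup>2 * d\<close>. The outer factor
  \<open>c\<close> comes from the l1 bound over components.\<close>

lemma mean_score_expansion:
  fixes cl :: "real ^ 'p::finite \<Rightarrow> real ^ 'm \<Rightarrow> real" and H :: "real ^ 'p ^ 'p"
  assumes n: "n > 0" and ball: "ball \<theta> \<rho> \<subseteq> N" "t \<in> ball \<theta> \<rho>"
    and smooth: "\<And>m. m < n \<Longrightarrow> Ck_on 3 (\<lambda>s. cl s (y m)) N"
    and dominated: "\<And>m z i j k. m < n \<Longrightarrow> z \<in> N \<Longrightarrow>
      \<bar>partial_deriv i (partial_deriv j (partial_deriv k (\<lambda>s. cl s (y m)))) z\<bar> \<le> D (y m)"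
    and sym: "transpose H = H"
    and H: "\<And>i j. \<bar>(\<Sum>m<n. score_deriv cl \<theta> (y m) $ i $ j) / real n + H $ i $ j\<bar> \<le> \<eta>"
    and D: "(\<Sum>m<n. D (y m)) / real n \<le> d"
  defines "c \<equiv> real CARD('p)"
  shows "norm ((1 / real n) *\<^sub>R (\<Sum>m<n. score cl t (y m)) - (1 / real n) *\<^sub>R (\<Sum>m<n. score cl \<theta> (y m))
      + H *v (t - \<theta>)) \<le> c * (c * \<eta> + c\<^sup>2 * d * norm (t - \<theta>)) * norm (t - \<theta>)"
proof -
  define x where "x = t - \<theta>"
  define r where "r m j = score cl t (y m) $ j - score cl \<theta> (y m) $ j
      - (\<Sum>i\<in>UNIV. x $ i * score_deriv cl \<theta> (y m) $ i $ j)" for m j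
  have r: "\<bar>r m j\<bar> \<le> c\<^sup>2 * D (y m) * (norm x)\<^sup>2" if m: "m < n" for m j
  proof -
    have "Ck_on 2 (\<lambda>s. score cl s (y m) $ j) N"
      using smooth[OF m] by (simp add: score_def numeral_3_eq_3 numeral_2_eq_2)
    then have "\<bar>score cl t (y m) $ j - score cl \<theta> (y m) $ j
        - (\<Sum>i\<in>UNIV. (t - \<theta>) $ i * partial_deriv i (\<lambda>s. score cl s (y m) $ j) \<theta>)\<bar>
        \<le> c\<^sup>2 * D (y m) * (norm (t - \<theta>))\<^sup>2"
      unfolding c_def using ball
      by (rule second_order_remainder_bound) (use dominated[OF m] in \<open>auto simp: score_def\<close>)
    then show ?thesis
      by (simp add: r_def x_def score_deriv_def)
  qed
  define v where "v = (1 / real n) *\<^sub>R (\<Sum>m<n. score cl t (y m))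
      - (1 / real n) *\<^sub>R (\<Sum>m<n. score cl \<theta> (y m)) + H *v x"
  have comp: "\<bar>v $ j\<bar> \<le> c\<^sup>2 * d * (norm x)\<^sup>2 + c * \<eta> * norm x" for j
  proof -
    define E where "E i = (\<Sum>m<n. score_deriv cl \<theta> (y m) $ i $ j) / real n + H $ i $ j" for i
    \<comment> \<open>In \<open>score_deriv\<close> the first index is the direction of
      differentiation and the second the score component, so the linear term is a product with the
      transpose; symmetry of \<open>H\<close> reconciles the two.\<close>
    have Hx: "(H *v x) $ j = (\<Sum>i\<in>UNIV. x $ i * H $ i $ j)"
    proof -
      have "(H *v x) $ j = (transpose H *v x) $ j"
        by (simp add: sym del: transpose_matrix_vector)
      then show ?thesis
        by (simp add: vector_matrix_mult_def mult.commute)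
    qed
    have "(\<Sum>m<n. r m j) = (\<Sum>m<n. score cl t (y m) $ j) - (\<Sum>m<n. score cl \<theta> (y m) $ j)
        - (\<Sum>i\<in>UNIV. x $ i * (\<Sum>m<n. score_deriv cl \<theta> (y m) $ i $ j))"
      unfolding r_def sum_subtractf sum_distrib_left
      by (subst sum.swap[of _ UNIV]) simp
    \<comment> \<open>Averaged Taylor remainder plus the deviation of the mean derivative from
      \<open>- H\<close>.\<close>
    then have "v $ j = (\<Sum>m<n. r m j) / real n + (\<Sum>i\<in>UNIV. x $ i * E i)"
      using n by (simp add: v_def E_def Hx sum.distrib distrib_left diff_divide_distrib
          sum_divide_distrib[of _ "UNIV :: 'p set"])
    then have "\<bar>v $ j\<bar> \<le> \<bar>(\<Sum>m<n. r m j) / real n\<bar> + \<bar>\<Sum>i\<in>UNIV. x $ i * E i\<bar>"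
      by (simp only: abs_triangle_ineq)
    also have "\<bar>(\<Sum>m<n. r m j) / real n\<bar> \<le> c\<^sup>2 * d * (norm x)\<^sup>2"
    proof -
      have "\<bar>\<Sum>m<n. r m j\<bar> \<le> (\<Sum>m<n. c\<^sup>2 * D (y m) * (norm x)\<^sup>2)"
        using r by (intro order_trans[OF sum_abs sum_mono]) auto
      then have "\<bar>(\<Sum>m<n. r m j) / real n\<bar> \<le> (\<Sum>m<n. c\<^sup>2 * D (y m) * (norm x)\<^sup>2) / real n"
        by (simp add: divide_right_mono)
      also have "\<dots> = c\<^sup>2 * (norm x)\<^sup>2 * ((\<Sum>m<n. D (y m)) / real n)"
        by (simp add: sum_distrib_left sum_divide_distrib mult_ac)
      also have "\<dots> \<le> c\<^sup>2 * (norm x)\<^sup>2 * d"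
        by (intro mult_left_mono D) simp
      finally show ?thesis by (simp add: mult_ac)
    qed
    also have "\<bar>\<Sum>i\<in>UNIV. x $ i * E i\<bar> \<le> (\<Sum>i\<in>(UNIV::'p set). norm x * \<eta>)"
    proof (rule order_trans[OF sum_abs sum_mono])
      show "\<bar>x $ i * E i\<bar> \<le> norm x * \<eta>" for i
        unfolding abs_mult E_def by (intro mult_mono H component_le_norm_cart) auto
    qed
    finally show ?thesis
      by (simp add: c_def mult_ac)
  qed
  have "norm v \<le> (\<Sum>j\<in>UNIV. \<bar>v $ j\<bar>)"
    by (rule norm_le_l1_cart)
  also have "\<dots> \<le> (\<Sum>j\<in>(UNIV::'p set). c\<^sup>2 * d * (norm x)\<^sup>2 + c * \<eta> * norm x)"
    by (intro sum_mono comp)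
  also have "\<dots> = c * (c * \<eta> + c\<^sup>2 * d * norm x) * norm x"
    by (simp add: c_def algebra_simps power2_eq_square)
  finally show ?thesis
    by (simp add: v_def x_def)
qed

section \<open>Asymptotic linear relation between the restricted and the unrestricted
  estimator\<close>

theorem lemma2:
  fixes \<nu> :: "'m::finite \<Rightarrow> real measure"
    and \<Theta> N :: "(real ^ 'p::finite) set"
    and f :: "real ^ 'p \<Rightarrow> real ^ 'm \<Rightarrow> real"
    and K :: nat and A B :: "nat \<Rightarrow> 'm set" and w :: "nat \<Rightarrow> real"
    and g :: "real ^ 'p \<Rightarrow> real ^ 'r::finite"
    and \<theta> :: "real ^ 'p"
    and D :: "real ^ 'm \<Rightarrow> real"
    and M :: "'w measure" and Y :: "nat \<Rightarrow> 'w \<Rightarrow> real ^ 'm"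
    and \<theta>c \<theta>rc :: "nat \<Rightarrow> 'w \<Rightarrow> real ^ 'p"
  defines "cl \<equiv> composite_log_density \<nu> K A B w f"
    and "P \<equiv> law \<nu> f"
    and "G \<equiv> G_matrix g"
  \<comment> \<open>parametric family and composite likelihood\<close>
  assumes dominating_measures: "\<And>j. sigma_finite_measure (\<nu> j)" "\<And>j. sets (\<nu> j) = sets borel"
    and densities: "\<And>t. t \<in> \<Theta> \<Longrightarrow> f t \<in> borel_measurable borel" "\<And>t y. t \<in> \<Theta> \<Longrightarrow> 0 \<le> f t y"
      "\<And>t. t \<in> \<Theta> \<Longrightarrow> prob_space (P t)"
    and identifiable: "inj_on P \<Theta>"
    and components: "\<And>k. k < K \<Longrightarrow> B k \<subset> A k" "\<And>k. k < K \<Longrightarrow> 0 \<le> w k"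
  \<comment> \<open>the constraint\<close>
    and dims: "CARD('r) < CARD('p)"
    and restriction: "\<And>t. t \<in> interior \<Theta> \<Longrightarrow> g differentiable (at t)"
      "continuous_on (interior \<Theta>) G" "\<And>t. t \<in> interior \<Theta> \<Longrightarrow> rank (G t) = CARD('r)"
  \<comment> \<open>true parameter and i.i.d. observations\<close>
    and true_parameter: "\<theta> \<in> interior \<Theta>" "g \<theta> = 0"
    and prob: "prob_space M"
    and iid: "prob_space.indep_vars M (\<lambda>_. borel) Y UNIV"
      "\<And>i. distributed M (dominating \<nu>) (Y i) (\<lambda>y. ennreal (f \<theta> y))"
  \<comment> \<open>regularity\<close>
    and support: "\<And>s t. s \<in> \<Theta> \<Longrightarrow> t \<in> \<Theta> \<Longrightarrow>
      {y. composite_density \<nu> K A B w f s y > 0} = {y. composite_density \<nu> K A B w f t y > 0}"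
    and neighbourhood: "open N" "\<theta> \<in> N" "N \<subseteq> \<Theta>"
    and smooth: "AE y in P \<theta>. Ck_on 3 (\<lambda>t. cl t y) N"
    and dominated: "AE y in P \<theta>. \<forall>t\<in>N. \<forall>i j k.
        \<bar>partial_deriv i (partial_deriv j (partial_deriv k (\<lambda>s. cl s y))) t\<bar> \<le> D y"
      "integrable (P \<theta>) D"
    and score_mean: "integrable (P \<theta>) (score cl \<theta>)" "(LINT y|P \<theta>. score cl \<theta> y) = 0"
    and H_finite: "\<And>i j. integrable (P \<theta>) (\<lambda>y. score_deriv cl \<theta> y $ i $ j)"
    and J_finite: "\<And>i j. integrable (P \<theta>) (\<lambda>y. score cl \<theta> y $ i * score cl \<theta> y $ j)"
    and pos_def: "positive_definite (H_matrix (P \<theta>) cl \<theta>)"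
      "positive_definite (J_matrix (P \<theta>) cl \<theta>)"
  \<comment> \<open>estimators\<close>
    and estimators: "\<And>n. \<theta>c n \<in> borel_measurable M" "\<And>n. \<theta>rc n \<in> borel_measurable M"
    and unrestricted:
      "with_prob_tending_to_1 M (\<lambda>n \<omega>. unrestricted_mcle \<Theta> cl n (\<lambda>i. Y i \<omega>) (\<theta>c n \<omega>))"
    and restricted:
      "with_prob_tending_to_1 M (\<lambda>n \<omega>. restricted_mcle \<Theta> g cl n (\<lambda>i. Y i \<omega>) (\<theta>rc n \<omega>))"
    and consistent: "tendsto_in_prob M \<theta>c \<theta>" "tendsto_in_prob M \<theta>rc \<theta>"
  shows "o_P_1 M (\<lambda>n \<omega>. sqrt (real n) *\<^sub>R (\<theta>rc n \<omega> - \<theta>)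
           - (mat 1 + Q_matrix (H_matrix (P \<theta>) cl \<theta>) (G \<theta>) ** transpose (G \<theta>))
             *v (sqrt (real n) *\<^sub>R (\<theta>c n \<omega> - \<theta>)))"
proof -
  interpret prob_space M by (rule prob)
  define H where "H = H_matrix (P \<theta>) cl \<theta>"
  define c where "c = real CARD('p)"
  \<comment> \<open>Bounds the sample mean of \<open>D\<close> as soon as this is within 1 of its
    expectation; the absolute value guarantees \<open>d > 0\<close>.\<close>
  define d where "d = \<bar>LINT y|P \<theta>. D y\<bar> + 1"
  have Y[measurable]: "Y i \<in> borel_measurable M" for i
    using iid(1) by (auto simp: indep_vars_def)
  have law: "distr M borel (Y i) = P \<theta>" for i
  proof -
    have "distr M borel (Y i) = distr M (dominating \<nu>) (Y i)"
      by (rule distr_cong) (auto simp: dominating_def)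
    then show ?thesis
      using distributed_distr_eq_density[OF iid(2)] by (simp add: P_def law_def)
  qed
  have sets_P: "sets (P \<theta>) = sets borel"
    using law[of 0] by (metis sets_distr)
  have score_meas[measurable]: "score cl \<theta> \<in> borel_measurable borel"
    using score_mean(1) sets_P by (metis borel_measurable_integrable measurable_cong_sets)
  have A_meas[measurable]: "(\<lambda>y. score_deriv cl \<theta> y $ i $ j) \<in> borel_measurable borel" for i j
    using H_finite[of i j] sets_P by (metis borel_measurable_integrable measurable_cong_sets)
  have D_meas[measurable]: "D \<in> borel_measurable borel"
    using dominated(2) sets_P by (metis borel_measurable_integrable measurable_cong_sets)
  have H_pd: "positive_definite H"
    using pos_def(1) by (simp add: H_def)
  have sym: "transpose H = H"
    using H_pd by (simp add: positive_definite_def)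
  obtain C \<delta>0 where C: "C > 0" "\<delta>0 > 0" and linear:
    "\<And>\<delta> s a b l e1 e2 e3. \<lbrakk>0 \<le> \<delta>; \<delta> \<le> \<delta>0; H *v a = s + e1; H *v b = s + G \<theta> *v l + e2;
        transpose (G \<theta>) *v b = e3; norm e1 \<le> \<delta> * norm a; norm e2 \<le> \<delta> * (norm b + norm l);
        norm e3 \<le> \<delta> * norm b\<rbrakk>
      \<Longrightarrow> norm (b - (mat 1 + Q_matrix H (G \<theta>) ** transpose (G \<theta>)) *v a) \<le> C * \<delta> * norm s"
    using linearised_equations_perturbation[OF H_pd restriction(3)[OF true_parameter(1)]] by blast
  define s where "s n \<omega> = (1 / sqrt (real n)) *\<^sub>R (\<Sum>i<n. score cl \<theta> (Y i \<omega>))" for n \<omega>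
  define X where "X n \<omega> = sqrt (real n) *\<^sub>R (\<theta>rc n \<omega> - \<theta>)
      - (mat 1 + Q_matrix H (G \<theta>) ** transpose (G \<theta>)) *v (sqrt (real n) *\<^sub>R (\<theta>c n \<omega> - \<theta>))" for n \<omega>
  note [measurable] = estimators
  have s_meas: "s n \<in> borel_measurable M" for n
    unfolding s_def[abs_def] by measurable
  have X_meas: "X n \<in> borel_measurable M" for n
  proof -
    have "(\<lambda>\<omega>. (mat 1 + Q_matrix H (G \<theta>) ** transpose (G \<theta>)) *v (sqrt (real n) *\<^sub>R (\<theta>c n \<omega> - \<theta>)))
        \<in> borel_measurable M"
      by (rule borel_measurable_continuous_on[OF matrix_vector_mult_linear_continuous_on]) measurable
    then show ?thesis
      unfolding X_def[abs_def] by (intro borel_measurable_diff) measurable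
  qed
  \<comment> \<open>Countably many observations contribute countably many null sets. The quantifier
    over \<open>n\<close> fits the shape of \<open>with_prob_tending_to_1_AE\<close>.\<close>
  have AE_good: "AE \<omega> in M. \<forall>n m. Ck_on 3 (\<lambda>t. cl t (Y m \<omega>)) N \<and> (\<forall>t\<in>N. \<forall>i j k.
        \<bar>partial_deriv i (partial_deriv j (partial_deriv k (\<lambda>s. cl s (Y m \<omega>)))) t\<bar> \<le> D (Y m \<omega>))"
  proof -
    have "AE \<omega> in M. Ck_on 3 (\<lambda>t. cl t (Y m \<omega>)) N \<and> (\<forall>t\<in>N. \<forall>i j k.
        \<bar>partial_deriv i (partial_deriv j (partial_deriv k (\<lambda>s. cl s (Y m \<omega>)))) t\<bar> \<le> D (Y m \<omega>))" for m
    proof -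
      have "AE y in distr M borel (Y m). Ck_on 3 (\<lambda>t. cl t y) N \<and> (\<forall>t\<in>N. \<forall>i j k.
          \<bar>partial_deriv i (partial_deriv j (partial_deriv k (\<lambda>s. cl s y))) t\<bar> \<le> D y)"
        unfolding law using smooth dominated(1) by eventually_elim simp
      then show ?thesis
        by (rule AE_distrD[OF Y])
    qed
    then show ?thesis
      by (simp add: AE_all_countable)
  qed
  have tight: "\<exists>b>0. \<forall>n. prob {\<omega> \<in> space M. norm (s n \<omega>) > b} \<le> \<eta>" if "\<eta> > 0" for \<eta>
    unfolding s_def
  proof (rule normalised_sum_tight[OF iid(1) law _ _ _ that])
    fix j
    show "integrable (P \<theta>) (\<lambda>y. score cl \<theta> y $ j)"
      by (rule integrable_bounded_linear[OF bounded_linear_vec_nth score_mean(1)])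
    show "(LINT y|P \<theta>. score cl \<theta> y $ j) = 0"
      using integral_bounded_linear[OF bounded_linear_vec_nth score_mean(1), of j] score_mean(2) by simp
    show "integrable (P \<theta>) (\<lambda>y. (score cl \<theta> y $ j)\<^sup>2)"
      using J_finite[of j j] by (simp add: power2_eq_square)
  qed
  have lln_A: "tendsto_in_prob M (\<lambda>n \<omega>. (\<Sum>m<n. score_deriv cl \<theta> (Y m \<omega>) $ i $ j) / real n) (- H $ i $ j)"
    for i j
    using weak_law_of_large_numbers[OF iid(1) law H_finite[of i j]] by (simp add: H_def H_matrix_def)
  have lln_D: "tendsto_in_prob M (\<lambda>n \<omega>. (\<Sum>m<n. D (Y m \<omega>)) / real n) (LINT y|P \<theta>. D y)"
    by (rule weak_law_of_large_numbers[OF iid(1) law dominated(2)])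
  have "c > 0" "d > 0"
    by (simp_all add: c_def d_def add_nonneg_pos)
  have main: "with_prob_tending_to_1 M (\<lambda>n \<omega>. norm (X n \<omega>) \<le> C * \<delta> * norm (s n \<omega>))"
    if \<delta>: "0 < \<delta>" "\<delta> \<le> \<delta>0" for \<delta>
  proof -
    obtain \<rho> where \<rho>: "\<rho> > 0" "ball \<theta> \<rho> \<subseteq> N"
      using neighbourhood openE by blast
    have "(g has_derivative (\<lambda>h. transpose (G \<theta>) *v h)) (at \<theta>)"
      using restriction(1)[OF true_parameter(1)] unfolding jacobian_works by (simp add: G_def G_matrix_def)
    then obtain r1 where r1: "r1 > 0" "\<And>t. norm (t - \<theta>) < r1 \<Longrightarrow>
        norm (g t - g \<theta> - transpose (G \<theta>) *v (t - \<theta>)) \<le> \<delta> * norm (t - \<theta>)"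
      using \<delta> unfolding has_derivative_at_alt by blast
    \<comment> \<open>Division by \<open>c\<close> compensates the dimension factor of
      \<open>norm_matrix_vector_mult_le\<close>.\<close>
    have "\<delta> / c > 0"
      using \<delta> \<open>c > 0\<close> by simp
    then obtain r2 where r2: "r2 > 0" "\<And>t. t \<in> interior \<Theta> \<Longrightarrow> dist t \<theta> < r2 \<Longrightarrow> dist (G t) (G \<theta>) < \<delta> / c"
      using restriction(2) true_parameter(1) unfolding continuous_on_iff by blast
    \<comment> \<open>In turn: stay in the ball where the score is smooth, linearise the constraint,
      keep \<open>G\<close> close to its value at \<theta>, and make the quadratic Taylor term at
      most half of \<delta>. The halved radii turn the non-strict bounds from consistency into
      strict ones.\<close>
    define r where "r = min (min (\<rho> / 2) (r1 / 2)) (min (r2 / 2) (\<delta> / (2 * c ^ 3 * d)))"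
    have r: "r > 0" "r < \<rho>" "r < r1" "r < r2" "r \<le> \<delta> / (2 * c ^ 3 * d)"
      using \<rho>(1) r1(1) r2(1) \<delta> \<open>c > 0\<close> \<open>d > 0\<close> by (auto simp: r_def)
    \<comment> \<open>The other half of \<delta>:
      \<open>c * c * \<eta> = \<delta> / 2\<close>.\<close>
    define \<eta> where "\<eta> = \<delta> / (2 * c\<^sup>2)"
    have \<eta>: "\<eta> > 0"
      using \<delta> \<open>c > 0\<close> by (simp add: \<eta>_def)
    have coeff: "c * (c * \<eta> + c\<^sup>2 * d * x) \<le> \<delta>" if "x \<le> r" for x
    proof -
      have "c * (c * \<eta> + c\<^sup>2 * d * x) \<le> c * (c * \<eta> + c\<^sup>2 * d * (\<delta> / (2 * c ^ 3 * d)))"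
        using that r(5) \<open>c > 0\<close> \<open>d > 0\<close> by (intro mult_left_mono add_left_mono) auto
      also have "\<dots> = \<delta>"
        using \<open>c > 0\<close> \<open>d > 0\<close> by (simp add: \<eta>_def field_simps power2_eq_square power3_eq_cube)
      finally show ?thesis .
    qed
    \<comment> \<open>All randomness is collected here; what follows is deterministic for fixed
      \<open>n\<close> and \<omega>. The condition \<open>n > 0\<close> permits division by
      \<open>sqrt n\<close>.\<close>
    have events: "with_prob_tending_to_1 M (\<lambda>n \<omega>. n > 0 \<and>
        (\<forall>m. Ck_on 3 (\<lambda>t. cl t (Y m \<omega>)) N \<and> (\<forall>t\<in>N. \<forall>i j k.
          \<bar>partial_deriv i (partial_deriv j (partial_deriv k (\<lambda>s. cl s (Y m \<omega>)))) t\<bar> \<le> D (Y m \<omega>))) \<and>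
        (\<forall>i j. dist ((\<Sum>m<n. score_deriv cl \<theta> (Y m \<omega>) $ i $ j) / real n) (- H $ i $ j) \<le> \<eta>) \<and>
        dist ((\<Sum>m<n. D (Y m \<omega>)) / real n) (LINT y|P \<theta>. D y) \<le> 1 \<and>
        unrestricted_mcle \<Theta> cl n (\<lambda>i. Y i \<omega>) (\<theta>c n \<omega>) \<and>
        restricted_mcle \<Theta> g cl n (\<lambda>i. Y i \<omega>) (\<theta>rc n \<omega>) \<and>
        dist (\<theta>c n \<omega>) \<theta> \<le> r \<and> dist (\<theta>rc n \<omega>) \<theta> \<le> r)"
      by (intro with_prob_tending_to_1_conj with_prob_tending_to_1_all_finite
          with_prob_tending_to_1_eventually with_prob_tending_to_1_AE[OF AE_good]
          with_prob_tending_to_1_tendsto_in_prob[OF _ lln_A \<eta>]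
          with_prob_tending_to_1_tendsto_in_prob[OF _ lln_D]
          with_prob_tending_to_1_tendsto_in_prob[OF _ consistent(1) r(1)]
          with_prob_tending_to_1_tendsto_in_prob[OF _ consistent(2) r(1)]
          unrestricted restricted estimators eventually_gt_at_top) (auto intro!: borel_measurable_divide)
    then show ?thesis
    proof (rule with_prob_tending_to_1_mono, elim conjE)
      fix n \<omega>
      assume n: "n > 0"
        and good: "\<forall>m. Ck_on 3 (\<lambda>t. cl t (Y m \<omega>)) N \<and> (\<forall>t\<in>N. \<forall>i j k.
          \<bar>partial_deriv i (partial_deriv j (partial_deriv k (\<lambda>s. cl s (Y m \<omega>)))) t\<bar> \<le> D (Y m \<omega>))"
        and A: "\<forall>i j. dist ((\<Sum>m<n. score_deriv cl \<theta> (Y m \<omega>) $ i $ j) / real n) (- H $ i $ j) \<le> \<eta>"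
        and Dn: "dist ((\<Sum>m<n. D (Y m \<omega>)) / real n) (LINT y|P \<theta>. D y) \<le> 1"
        and uc: "unrestricted_mcle \<Theta> cl n (\<lambda>i. Y i \<omega>) (\<theta>c n \<omega>)"
        and rc: "restricted_mcle \<Theta> g cl n (\<lambda>i. Y i \<omega>) (\<theta>rc n \<omega>)"
        and close: "dist (\<theta>c n \<omega>) \<theta> \<le> r" "dist (\<theta>rc n \<omega>) \<theta> \<le> r"
      define q where "q = sqrt (real n)"
      have q: "q > 0" "q * q = real n"
        using n by (simp_all add: q_def)
      \<comment> \<open>The mean expansion multiplied by \<open>q = sqrt n\<close>, where
        \<open>q / n = 1 / q\<close>. It serves both estimators: the score sum is zero at the
        unrestricted one and is expressed by the multiplier at the restricted one.\<close>
      have score_expansion: "norm (H *v (q *\<^sub>R (t - \<theta>)) - s n \<omega> + (1 / q) *\<^sub>R (\<Sum>m<n. score cl t (Y m \<omega>)))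
          \<le> \<delta> * norm (q *\<^sub>R (t - \<theta>))" if t: "dist t \<theta> \<le> r" for t
      proof -
        define V where "V = (1 / real n) *\<^sub>R (\<Sum>m<n. score cl t (Y m \<omega>))
            - (1 / real n) *\<^sub>R (\<Sum>m<n. score cl \<theta> (Y m \<omega>)) + H *v (t - \<theta>)"
        have "norm V \<le> c * (c * \<eta> + c\<^sup>2 * d * norm (t - \<theta>)) * norm (t - \<theta>)"
          unfolding V_def c_def
        proof (rule mean_score_expansion[OF n \<rho>(2) _ _ _ sym])
          show "t \<in> ball \<theta> \<rho>"
            using t r(2) by (simp add: dist_commute)
          show "\<bar>(\<Sum>m<n. score_deriv cl \<theta> (Y m \<omega>) $ i $ j) / real n + H $ i $ j\<bar> \<le> \<eta>" for i j
            using A by (simp add: dist_real_def)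
          show "(\<Sum>m<n. D (Y m \<omega>)) / real n \<le> d"
            using Dn unfolding dist_real_def d_def by linarith
        qed (use good in auto)
        also have "\<dots> \<le> \<delta> * norm (t - \<theta>)"
          using t by (intro mult_right_mono coeff) (simp_all add: dist_norm)
        finally have "q * norm V \<le> q * (\<delta> * norm (t - \<theta>))"
          using q by (intro mult_left_mono) auto
        moreover have "H *v (q *\<^sub>R (t - \<theta>)) - s n \<omega> + (1 / q) *\<^sub>R (\<Sum>m<n. score cl t (Y m \<omega>)) = q *\<^sub>R V"
          using q by (simp add: V_def s_def q_def[symmetric] q(2)[symmetric] matrix_vector_mult_scaleR algebra_simps)
        ultimately show ?thesis
          using q by (simp add: mult_ac)
      qed
      define a where "a = q *\<^sub>R (\<theta>c n \<omega> - \<theta>)"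
      define b where "b = q *\<^sub>R (\<theta>rc n \<omega> - \<theta>)"
      obtain l0 where l0: "(\<Sum>i<n. score cl (\<theta>rc n \<omega>) (Y i \<omega>)) + G (\<theta>rc n \<omega>) *v l0 = 0"
        using rc by (auto simp: restricted_mcle_def G_def)
      \<comment> \<open>The multiplier is put on the scale of \<open>s\<close>. Its size is not
        known beforehand, which is why the linear lemma tolerates an error proportional to
        \<open>norm l\<close>.\<close>
      define l where "l = (1 / q) *\<^sub>R l0"
      define e where "e = H *v b - s n \<omega> + (1 / q) *\<^sub>R (\<Sum>m<n. score cl (\<theta>rc n \<omega>) (Y m \<omega>))"
      have e: "norm e \<le> \<delta> * norm b"
        using score_expansion[OF close(2)] by (simp add: e_def b_def)
      \<comment> \<open>Taylor error plus the cost of replacing \<open>G\<close> at the restricted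
        estimator by \<open>G\<close> at \<theta>.\<close>
      define e2 where "e2 = e + (G (\<theta>rc n \<omega>) - G \<theta>) *v l"
      have "norm (b - (mat 1 + Q_matrix H (G \<theta>) ** transpose (G \<theta>)) *v a) \<le> C * \<delta> * norm (s n \<omega>)"
      proof (rule linear)
        show "0 \<le> \<delta>" "\<delta> \<le> \<delta>0"
          using \<delta> by auto
        show "H *v a = s n \<omega> + (H *v a - s n \<omega>)"
          by simp
        show "norm (H *v a - s n \<omega>) \<le> \<delta> * norm a"
          using score_expansion[OF close(1)] uc by (simp add: a_def unrestricted_mcle_def)
        have "(1 / q) *\<^sub>R (\<Sum>m<n. score cl (\<theta>rc n \<omega>) (Y m \<omega>)) = - (G (\<theta>rc n \<omega>) *v l)"
          using l0 by (simp add: l_def matrix_vector_mult_scaleR eq_neg_iff_add_eq_0 flip: scaleR_add_right)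
        then show "H *v b = s n \<omega> + G \<theta> *v l + e2"
          by (simp add: e2_def e_def matrix_vector_mult_diff_rdistrib)
        have "norm ((G (\<theta>rc n \<omega>) - G \<theta>) *v l) \<le> c * norm (G (\<theta>rc n \<omega>) - G \<theta>) * norm l"
          unfolding c_def by (rule norm_matrix_vector_mult_le)
        also have "\<dots> \<le> c * (\<delta> / c) * norm l"
        proof (intro mult_right_mono mult_left_mono)
          have "ball \<theta> \<rho> \<subseteq> interior \<Theta>"
            using \<rho>(2) neighbourhood(3) by (intro interior_maximal) auto
          then have "\<theta>rc n \<omega> \<in> interior \<Theta>"
            using close(2) r(2) by (auto simp: dist_commute)
          then show "norm (G (\<theta>rc n \<omega>) - G \<theta>) \<le> \<delta> / c"
            using r2(2) close(2) r(4) by (force simp: dist_norm)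
        qed (use \<open>c > 0\<close> in auto)
        finally have "norm ((G (\<theta>rc n \<omega>) - G \<theta>) *v l) \<le> \<delta> * norm l"
          using \<open>c > 0\<close> by simp
        then show "norm e2 \<le> \<delta> * (norm b + norm l)"
          using e norm_triangle_ineq[of e "(G (\<theta>rc n \<omega>) - G \<theta>) *v l"]
          unfolding e2_def distrib_left by linarith
        \<comment> \<open>Both \<open>g\<close> values in \<open>r1\<close> are zero, so the
          constraint leaves only its linear term.\<close>
        have "norm (transpose (G \<theta>) *v (\<theta>rc n \<omega> - \<theta>)) \<le> \<delta> * norm (\<theta>rc n \<omega> - \<theta>)"
          using r1(2)[of "\<theta>rc n \<omega>"] close(2) r(3) rc true_parameter(2)
          by (simp add: restricted_mcle_def dist_norm del: transpose_matrix_vector)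
        then show "norm (transpose (G \<theta>) *v b) \<le> \<delta> * norm b"
          using q by (simp add: b_def matrix_vector_mult_scaleR del: transpose_matrix_vector)
      qed simp
      then show "norm (X n \<omega>) \<le> C * \<delta> * norm (s n \<omega>)"
        by (simp add: X_def a_def b_def q_def)
    qed
  qed
  have "o_P_1 M X"
  proof (rule o_P_1_tight_product[OF X_meas _ tight])
    show "(\<lambda>\<omega>. norm (s n \<omega>)) \<in> borel_measurable M" for n
      using s_meas[of n] by measurable
    show "C * \<delta>0 > 0"
      using C by simp
    \<comment> \<open>Applying \<open>main\<close> to \<open>\<delta> / C\<close> removes the
      constant \<open>C\<close> and turns the range \<open>\<delta>0\<close> into
      \<open>C * \<delta>0\<close>.\<close>
    show "with_prob_tending_to_1 M (\<lambda>n \<omega>. norm (X n \<omega>) \<le> \<delta> * norm (s n \<omega>))"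
      if "0 < \<delta>" "\<delta> \<le> C * \<delta>0" for \<delta>
      using main[of "\<delta> / C"] that C by (simp add: field_simps)
  qed
  then show ?thesis
    unfolding X_def H_def .
qed

end
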